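(* For every $p\in[1,\infty)$, the Banach algebras $\mathcal A/\mathcal J$ and $\mathcal O_2^p$ are not isomorphic (there is no bijective continuous algebra homomorphism between them).
   Context: Let $\mathrm{Cu}_2$ be the involutive monoid with identity $e$ and zero element $\lozenge$ (so $\lozenge t=\lozenge=t\lozenge$ for all $t$), generated by $s_1,s_2,s_1^*,s_2^*$ subject to $s_1^*s_1=e=s_2^*s_2$ and $s_1^*s_2=\lozenge=s_2^*s_1$, with involution $t\mapsto t^*$ satisfying $(t^* )^*=t$, $(tu)^*=u^*t^*$. Let $\mathcal A=\ell^1(\mathrm{Cu}_2\setminus\{\lozenge\})$ with product $\#$ determined by bilinearity and continuity from $\delta_s\#\delta_t=\delta_{st}$ if $st\neq\lozenge$ and $\delta_s\#\delta_t=0$ if $st=\lozenge$; this is a unital Banach algebra with unit $\delta_e$. Let $f_0=\delta_e-\delta_{s_1s_1^*}-\delta_{s_2s_2^*}$ and let $\mathcal J$ be the closed two-sided ideal of $\mathcal A$ generated by $f_0$; $\mathcal A/\mathcal J$ carries the quotient norm. For $\ell^p=\ell^p(\mathbb N)$ define $A_1,A_2,B_1,B_2\in\mathcal B(\ell^p)$ by $(A_1x)(n)=x_{2n}$, $(A_2x)(n)=x_{2n-1}$, $(B_1x)(n)=x_{n/2}$ if $n$ is even and $0$ otherwise, $(B_2x)(n)=x_{(n+1)/2}$ if $n$ is odd and $0$ otherwise. $\mathcal O_2^p$ denotes the norm closure in $\mathcal B(\ell^p)$ of the unital subalgebra generated by $A_1,A_2,B_1,B_2$. *)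

theory Defs
  imports "HOL-Analysis.Analysis"
begin

record 'a calg =
  carrier :: "'a set"
  add :: "'a \<Rightarrow> 'a \<Rightarrow> 'a"
  smul :: "complex \<Rightarrow> 'a \<Rightarrow> 'a"
  mul :: "'a \<Rightarrow> 'a \<Rightarrow> 'a"
  adist :: "'a \<Rightarrow> 'a \<Rightarrow> real"

definition alg_hom :: "'a calg \<Rightarrow> 'b calg \<Rightarrow> ('a \<Rightarrow> 'b) \<Rightarrow> bool" where
  "alg_hom A B \<phi> \<longleftrightarrow>
     (\<forall>x\<in>carrier A. \<forall>y\<in>carrier A.
        \<phi> (add A x y) = add B (\<phi> x) (\<phi> y) \<and> \<phi> (mul A x y) = mul B (\<phi> x) (\<phi> y)) \<and>
     (\<forall>c. \<forall>x\<in>carrier A. \<phi> (smul A c x) = smul B c (\<phi> x))"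

definition alg_cont :: "'a calg \<Rightarrow> 'b calg \<Rightarrow> ('a \<Rightarrow> 'b) \<Rightarrow> bool" where
  "alg_cont A B \<phi> \<longleftrightarrow>
     (\<forall>x\<in>carrier A. \<forall>e>0. \<exists>d>0. \<forall>y\<in>carrier A.
        adist A x y < d \<longrightarrow> adist B (\<phi> x) (\<phi> y) < e)"

definition alg_iso :: "'a calg \<Rightarrow> 'b calg \<Rightarrow> ('a \<Rightarrow> 'b) \<Rightarrow> bool" where
  "alg_iso A B \<phi> \<longleftrightarrow> bij_betw \<phi> (carrier A) (carrier B) \<and> alg_hom A B \<phi> \<and> alg_cont A B \<phi>"

datatype gen = S1 | S2 | S1s | S2s | Zg

inductive cu_rel :: "gen list \<Rightarrow> gen list \<Rightarrow> bool" where
  cu_refl: "cu_rel w w"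
| cu_sym: "cu_rel v w \<Longrightarrow> cu_rel w v"
| cu_trans: "cu_rel u v \<Longrightarrow> cu_rel v w \<Longrightarrow> cu_rel u w"
| cu_ctx: "cu_rel v w \<Longrightarrow> cu_rel (a @ v @ b) (a @ w @ b)"
| cu_r1: "cu_rel [S1s, S1] []"
| cu_r2: "cu_rel [S2s, S2] []"
| cu_r3: "cu_rel [S1s, S2] [Zg]"
| cu_r4: "cu_rel [S2s, S1] [Zg]"
| cu_zl: "cu_rel [Zg, x] [Zg]"
| cu_zr: "cu_rel [x, Zg] [Zg]"

definition cu_class :: "gen list \<Rightarrow> gen list set" where
  "cu_class w = {v. cu_rel w v}"

definition Cu2 :: "gen list set set" where
  "Cu2 = range cu_class"

definition cu_mult :: "gen list set \<Rightarrow> gen list set \<Rightarrow> gen list set" where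
  "cu_mult X Y = (\<Union>a\<in>X. \<Union>b\<in>Y. cu_class (a @ b))"

definition cu_e :: "gen list set" where "cu_e = cu_class []"
definition cu_zero :: "gen list set" where "cu_zero = cu_class [Zg]"

definition Cu2nz :: "gen list set set" where
  "Cu2nz = Cu2 - {cu_zero}"

definition ell1 :: "(gen list set \<Rightarrow> complex) set" where
  "ell1 = {f. (\<forall>s. s \<notin> Cu2nz \<longrightarrow> f s = 0) \<and> (\<lambda>s. norm (f s)) summable_on Cu2nz}"

definition l1norm :: "(gen list set \<Rightarrow> complex) \<Rightarrow> real" where
  "l1norm f = (\<Sum>\<^sub>\<infinity>s\<in>Cu2nz. norm (f s))"

text \<open>The product: continuous bilinear extension of
  delta_s # delta_t = delta_(st) (or 0 if st is the zero).\<close>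
definition conv :: "(gen list set \<Rightarrow> complex) \<Rightarrow> (gen list set \<Rightarrow> complex) \<Rightarrow> gen list set \<Rightarrow> complex" where
  "conv f g u = (if u \<in> Cu2nz then
      (\<Sum>\<^sub>\<infinity>(s,t)\<in>{(s,t). s \<in> Cu2nz \<and> t \<in> Cu2nz \<and> cu_mult s t = u}. f s * g t)
    else 0)"

definition delta :: "gen list set \<Rightarrow> gen list set \<Rightarrow> complex" where
  "delta s = (\<lambda>t. if t = s then 1 else 0)"

definition f0 :: "gen list set \<Rightarrow> complex" where
  "f0 = (\<lambda>t. delta cu_e t - delta (cu_class [S1, S1s]) t - delta (cu_class [S2, S2s]) t)"

definition is_closed_ideal :: "(gen list set \<Rightarrow> complex) set \<Rightarrow> bool" where
  "is_closed_ideal I \<longleftrightarrow> I \<subseteq> ell1 \<and>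
     (\<forall>f\<in>I. \<forall>g\<in>I. (\<lambda>s. f s + g s) \<in> I) \<and>
     (\<forall>c. \<forall>f\<in>I. (\<lambda>s. c * f s) \<in> I) \<and>
     (\<forall>a\<in>ell1. \<forall>f\<in>I. conv a f \<in> I \<and> conv f a \<in> I) \<and>
     (\<forall>f\<in>ell1. (\<forall>e>0. \<exists>g\<in>I. l1norm (\<lambda>s. f s - g s) < e) \<longrightarrow> f \<in> I)"

definition J :: "(gen list set \<Rightarrow> complex) set" where
  "J = \<Inter>{I. is_closed_ideal I \<and> f0 \<in> I}"

definition coset :: "(gen list set \<Rightarrow> complex) \<Rightarrow> (gen list set \<Rightarrow> complex) set" where
  "coset f = {g\<in>ell1. (\<lambda>s. g s - f s) \<in> J}"

definition AJ :: "(gen list set \<Rightarrow> complex) set calg" where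
  "AJ = \<lparr> carrier = {coset f | f. f \<in> ell1},
          add = (\<lambda>X Y. {h\<in>ell1. \<exists>f\<in>X. \<exists>g\<in>Y. (\<lambda>s. h s - (f s + g s)) \<in> J}),
          smul = (\<lambda>c X. {h\<in>ell1. \<exists>f\<in>X. (\<lambda>s. h s - c * f s) \<in> J}),
          mul = (\<lambda>X Y. {h\<in>ell1. \<exists>f\<in>X. \<exists>g\<in>Y. (\<lambda>s. h s - conv f g s) \<in> J}),
          adist = (\<lambda>X Y. Inf {l1norm (\<lambda>s. f s - g s) | f g. f \<in> X \<and> g \<in> Y}) \<rparr>"

text \<open>Sequences indexed by positive naturals: functions on nat vanishing at 0.\<close>
definition lp :: "real \<Rightarrow> (nat \<Rightarrow> complex) set" where
  "lp p = {x. x 0 = 0 \<and> summable (\<lambda>n. norm (x n) powr p)}"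

definition lpnorm :: "real \<Rightarrow> (nat \<Rightarrow> complex) \<Rightarrow> real" where
  "lpnorm p x = (\<Sum>n. norm (x n) powr p) powr (1 / p)"

type_synonym op = "(nat \<Rightarrow> complex) \<Rightarrow> (nat \<Rightarrow> complex)"

text \<open>Operators are normalised to be 0 outside l^p, so that equality of
  operators is equality on l^p.\<close>
definition bdd_op :: "real \<Rightarrow> op \<Rightarrow> bool" where
  "bdd_op p T \<longleftrightarrow>
     (\<forall>x. x \<notin> lp p \<longrightarrow> T x = (\<lambda>n. 0)) \<and>
     (\<forall>x\<in>lp p. T x \<in> lp p) \<and>
     (\<forall>x\<in>lp p. \<forall>y\<in>lp p. T (\<lambda>n. x n + y n) = (\<lambda>n. T x n + T y n)) \<and>
     (\<forall>c. \<forall>x\<in>lp p. T (\<lambda>n. c * x n) = (\<lambda>n. c * T x n)) \<and>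
     (\<exists>C. \<forall>x\<in>lp p. lpnorm p (T x) \<le> C * lpnorm p x)"

definition opnorm :: "real \<Rightarrow> op \<Rightarrow> real" where
  "opnorm p T = Sup {lpnorm p (T x) | x. x \<in> lp p \<and> lpnorm p x \<le> 1}"

definition op_restr :: "real \<Rightarrow> op \<Rightarrow> op" where
  "op_restr p T = (\<lambda>x. if x \<in> lp p then T x else (\<lambda>n. 0))"

definition op_add :: "op \<Rightarrow> op \<Rightarrow> op" where
  "op_add S T = (\<lambda>x n. S x n + T x n)"

definition op_smul :: "complex \<Rightarrow> op \<Rightarrow> op" where
  "op_smul c T = (\<lambda>x n. c * T x n)"

definition op_mul :: "op \<Rightarrow> op \<Rightarrow> op" where
  "op_mul S T = (\<lambda>x. S (T x))"

definition opI :: "real \<Rightarrow> op" where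
  "opI p = op_restr p (\<lambda>x. x)"

definition opA1 :: "real \<Rightarrow> op" where
  "opA1 p = op_restr p (\<lambda>x n. if n = 0 then 0 else x (2 * n))"

definition opA2 :: "real \<Rightarrow> op" where
  "opA2 p = op_restr p (\<lambda>x n. if n = 0 then 0 else x (2 * n - 1))"

definition opB1 :: "real \<Rightarrow> op" where
  "opB1 p = op_restr p (\<lambda>x n. if n \<noteq> 0 \<and> even n then x (n div 2) else 0)"

definition opB2 :: "real \<Rightarrow> op" where
  "opB2 p = op_restr p (\<lambda>x n. if odd n then x ((n + 1) div 2) else 0)"

inductive_set gen_alg :: "real \<Rightarrow> op set" for p :: real where
  ga_I: "opI p \<in> gen_alg p"
| ga_A1: "opA1 p \<in> gen_alg p"
| ga_A2: "opA2 p \<in> gen_alg p"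
| ga_B1: "opB1 p \<in> gen_alg p"
| ga_B2: "opB2 p \<in> gen_alg p"
| ga_add: "S \<in> gen_alg p \<Longrightarrow> T \<in> gen_alg p \<Longrightarrow> op_add S T \<in> gen_alg p"
| ga_smul: "T \<in> gen_alg p \<Longrightarrow> op_smul c T \<in> gen_alg p"
| ga_mul: "S \<in> gen_alg p \<Longrightarrow> T \<in> gen_alg p \<Longrightarrow> op_mul S T \<in> gen_alg p"

definition O2p_set :: "real \<Rightarrow> op set" where
  "O2p_set p = {T. bdd_op p T \<and>
     (\<forall>e>0. \<exists>S\<in>gen_alg p. opnorm p (op_add T (op_smul (-1) S)) < e)}"

definition O2p :: "real \<Rightarrow> op calg" where
  "O2p p = \<lparr> carrier = O2p_set p, add = op_add, smul = op_smul, mul = op_mul,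
             adist = (\<lambda>S T. opnorm p (op_add S (op_smul (-1) T))) \<rparr>"

end

theory Submission
  imports Defs "HOL-Library.Sublist"
begin

text \<open>
  As a Banach space, \<open>\<A>/\<J>\<close> embeds into \<open>\<ell>\<^sup>1\<close>: the nonzero elements of the monoid are
  the \<open>s\<^sub>\<alpha>s\<^sub>\<beta>\<^sup>*\<close>, the ideal \<open>\<J>\<close> is the closed span of the elements
  \<open>\<delta>(\<alpha>,\<beta>) - \<delta>(\<alpha>1,\<beta>1) - \<delta>(\<alpha>2,\<beta>2)\<close>, and this span is the kernel of a bounded projection.
  On the other hand \<open>\<O>\<^sub>2\<^sup>p\<close> contains the diagonal operators given by residue classes modulo
  powers of 2, hence copies of \<open>c\<^sub>0\<close> in infinitely many orthogonal corners.

  Let \<open>\<theta>\<close> be any injective homomorphism \<open>\<O>\<^sub>2\<^sup>p \<rightarrow> \<A>/\<J>\<close>. Nonzero idempotents of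
  \<open>\<A>/\<J>\<close> have norm bounded below, so by Khinchin's inequality in \<open>\<ell>\<^sup>1\<close> signed sums of orthogonal
  diagonal projections inside the \<open>n\<close>-th corner \<open>P\<^sub>n\<close> have unbounded images. Choose such a sum
  \<open>y\<^sub>n\<close> with \<open>\<parallel>\<theta> y\<^sub>n\<parallel> > 4\<^sup>n \<parallel>\<theta> P\<^sub>n\<parallel>\<close>; then \<open>x = \<Sum> 2\<^sup>-\<^sup>n y\<^sub>n\<close> lies in \<open>\<O>\<^sub>2\<^sup>p\<close>, and \<open>x P\<^sub>n = 2\<^sup>-\<^sup>n y\<^sub>n\<close> is
  incompatible with \<open>\<parallel>\<theta> x\<parallel> < \<infinity>\<close>. An isomorphism in the other
  direction is excluded by applying this to its inverse.
\<close>

section \<open>Normal forms in the Cuntz monoid\<close>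

text \<open>The pair \<open>(a, b)\<close> stands for \<open>s\<^sub>\<alpha>s\<^sub>\<beta>\<^sup>*\<close> with \<open>\<alpha> = rev a\<close> and \<open>\<beta> = rev b\<close>: words are stored last
  letter first, so that passing from \<open>(\<alpha>, \<beta>)\<close> to \<open>(\<alpha>x, \<beta>x)\<close> is a pair of \<open>Cons\<close> operations.\<close>

type_synonym ix = "bool list \<times> bool list"

fun gen_of :: "bool \<Rightarrow> gen" where "gen_of True = S1" | "gen_of False = S2"
fun star_of :: "bool \<Rightarrow> gen" where "star_of True = S1s" | "star_of False = S2s"

definition word :: "ix \<Rightarrow> gen list" where
  "word i = rev (map gen_of (fst i)) @ map star_of (snd i)"

definition elt :: "ix \<Rightarrow> gen list set" where "elt i = cu_class (word i)"

text \<open>A prefix of a word is a suffix of its stored list. In the middle, s_beta^* s_gamma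
  leaves the rest of the longer word if one is a prefix of the other, and is zero otherwise;
  \<open>None\<close> is the zero of the monoid.\<close>

fun pmult :: "ix \<Rightarrow> ix \<Rightarrow> ix option" where
  "pmult (a, b) (c, d) =
     (if suffix b c then Some (take (length c - length b) c @ a, d)
      else if suffix c b then Some (a, take (length b - length c) b @ d) else None)"

text \<open>The action of the monoid by partial maps on finite words separates the normal forms.\<close>

fun step :: "gen \<Rightarrow> bool list \<Rightarrow> bool list option" where
  "step S1 x = Some (True # x)"
| "step S2 x = Some (False # x)"
| "step S1s x = (case x of True # y \<Rightarrow> Some y | _ \<Rightarrow> None)"
| "step S2s x = (case x of False # y \<Rightarrow> Some y | _ \<Rightarrow> None)"
| "step Zg x = None"

fun run :: "gen list \<Rightarrow> bool list option \<Rightarrow> bool list option" where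
  "run [] z = z"
| "run (g # w) z = Option.bind (run w z) (step g)"

lemma run_append: "run (v @ w) z = run v (run w z)"
  by (induction v) auto

text \<open>Each defining relation holds for the partial maps, with \<open>None\<close> as
  undefined, so \<open>run\<close> descends to the monoid.\<close>

lemma run_cong: "cu_rel v w \<Longrightarrow> run v z = run w z"
proof (induction arbitrary: z rule: cu_rel.induct)
  case (cu_zr x) show ?case by (cases z) auto
next
  case (cu_zl x) show ?case by (cases z; cases x) (auto simp: bind_eq_None_conv)
qed (auto simp: run_append Option.bind_eq_None_conv split: Option.bind_splits)

lemma run_gen_of: "run (rev (map gen_of a)) (Some x) = Some (rev a @ x)"
proof (induction a arbitrary: x)
  case (Cons b a) then show ?case by (cases b) (auto simp: run_append)
qed auto

lemma run_star_of: "run (map star_of b) (Some x) = (if prefix (rev b) x then Some (drop (length b) x) else None)"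
proof (induction b)
  case (Cons c b)
  show ?case
  proof (cases "prefix (rev b) x")
    case True
    then obtain y where y: "x = rev b @ y" by (auto simp: prefix_def)
    show ?thesis using Cons y by (cases c; cases y) (auto split: list.split bool.split)
  next
    case False
    then have "\<not> prefix (rev b @ [c]) x" by (meson append_prefixD)
    then show ?thesis using Cons False by simp
  qed
qed auto

lemma run_word: "run (word (a, b)) (Some x) =
    (if prefix (rev b) x then Some (rev a @ drop (length b) x) else None)"
  by (simp add: word_def run_append run_star_of run_gen_of) (induction a, auto simp: run_append)

lemma cu_class_eq: "cu_class v = cu_class w \<longleftrightarrow> cu_rel v w"
  unfolding cu_class_def by (metis (mono_tags) Collect_cong cu_refl cu_sym cu_trans mem_Collect_eq)

text \<open>The partial map of s_alpha s_beta^* is defined exactly on the words with prefix beta,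
  and it sends beta to alpha. So the map determines the pair.\<close>

lemma inj_elt: "inj elt"
proof (rule injI)
  fix i j assume "elt i = elt j"
  then have r: "run (word i) z = run (word j) z" for z
    by (simp add: elt_def cu_class_eq run_cong)
  obtain a b c d where ij: "i = (a, b)" "j = (c, d)" by (cases i, cases j)
  have 1: "prefix (rev d) (rev b)"
    using r[of "Some (rev b)"] by (simp add: ij run_word split: if_splits)
  have "prefix (rev b) (rev d)"
    using r[of "Some (rev d)"] by (simp add: ij run_word split: if_splits)
  with 1 have "b = d" using prefix_order.antisym rev_rev_ident by metis
  then show "i = j" using r[of "Some (rev b)"] by (simp add: ij run_word)
qed

lemma elt_ne_zero: "elt i \<noteq> cu_zero"
proof
  assume "elt i = cu_zero"
  then have "run (word i) z = run [Zg] z" for z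
    by (simp add: elt_def cu_zero_def cu_class_eq run_cong)
  moreover obtain a b where "i = (a, b)" by (cases i)
  ultimately have "Some (rev a) = Option.bind (Some (rev b)) (step Zg)"
    using run_word[of a b "rev b"] by auto
  then show False by simp
qed

section \<open>Reduction of words to normal form\<close>

lemma cu_rel_app: "cu_rel v v' \<Longrightarrow> cu_rel w w' \<Longrightarrow> cu_rel (v @ w) (v' @ w')"
  using cu_ctx[of v v' "[]" w] cu_ctx[of w w' v' "[]"]
    cu_trans[of "v @ w" "v' @ w" "v' @ w'"] by simp

lemma cu_zero_left: "cu_rel ([Zg] @ w) [Zg]"
proof (induction w)
  case (Cons g w)
  have "cu_rel ([Zg, g] @ w) ([Zg] @ w)" by (rule cu_rel_app[OF cu_zl cu_refl])
  from cu_trans[OF this Cons] show ?case by simp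
qed (auto intro: cu_refl)

lemma cu_zero_right: "cu_rel (w @ [Zg]) [Zg]"
proof (induction w)
  case (Cons g w)
  have "cu_rel ([g] @ (w @ [Zg])) ([g] @ [Zg])" by (rule cu_rel_app[OF cu_refl Cons])
  then show ?case using cu_zr[of g] cu_trans[of "g # w @ [Zg]" "[g, Zg]" "[Zg]"] by simp
qed (auto intro: cu_refl)

lemma cu_zero_mid: "cu_rel (v @ [Zg] @ w) [Zg]"
  by (rule cu_trans[OF cu_rel_app[OF cu_refl cu_zero_left] cu_zero_right])

lemma cu_cancel: "cu_rel [star_of x, gen_of x] []"
  by (cases x) (auto intro: cu_r1 cu_r2)

lemma cu_clash: "x \<noteq> y \<Longrightarrow> cu_rel [star_of x, gen_of y] [Zg]"
  by (cases x; cases y) (auto intro: cu_r3 cu_r4)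

text \<open>The stored lists end with the first letters of beta and gamma. These two letters meet in
  the middle, so the induction removes them: equal letters cancel, different ones give the
  zero.\<close>

lemma cu_mid:
  "cu_rel (map star_of b @ rev (map gen_of c))
     (if suffix b c then rev (map gen_of (take (length c - length b) c))
      else if suffix c b then map star_of (take (length b - length c) b) else [Zg])"
proof (induction b arbitrary: c rule: rev_induct)
  case Nil show ?case by (auto intro: cu_refl)
next
  case (snoc x b)
  show ?case
  proof (cases c rule: rev_cases)
    case Nil then show ?thesis by (auto intro: cu_refl)
  next
    case (snoc c0 y)
    have w: "map star_of (b @ [x]) @ rev (map gen_of c) = map star_of b @ [star_of x, gen_of y] @ rev (map gen_of c0)"
      by (simp add: snoc)
    show ?thesis
    proof (cases "x = y")
      case True
      have "cu_rel (map star_of b @ [star_of x, gen_of y] @ rev (map gen_of c0)) (map star_of b @ [] @ rev (map gen_of c0))"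
        using True cu_cancel cu_ctx by blast
      then have "cu_rel (map star_of b @ [star_of x, gen_of y] @ rev (map gen_of c0)) (map star_of b @ rev (map gen_of c0))"
        by simp
      from cu_trans[OF this snoc.IH] show ?thesis
        unfolding w using True snoc by (simp split: if_splits)
    next
      case False
      have "cu_rel (map star_of b @ [star_of x, gen_of y] @ rev (map gen_of c0)) (map star_of b @ [Zg] @ rev (map gen_of c0))"
        using False cu_clash cu_ctx by blast
      then show ?thesis unfolding w using cu_trans[OF _ cu_zero_mid] False snoc by simp
    qed
  qed
qed

lemma word_mult: "cu_rel (word i @ word j) (case pmult i j of Some k \<Rightarrow> word k | None \<Rightarrow> [Zg])"
proof -
  obtain a b c d where ij: "i = (a, b)" "j = (c, d)" by (cases i, cases j)
  have "cu_rel (rev (map gen_of a) @ (map star_of b @ rev (map gen_of c)) @ map star_of d)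
     (rev (map gen_of a) @ (if suffix b c then rev (map gen_of (take (length c - length b) c))
      else if suffix c b then map star_of (take (length b - length c) b) else [Zg]) @ map star_of d)"
    by (rule cu_ctx[OF cu_mid])
  note m = this
  have z: "cu_rel (rev (map gen_of a) @ [Zg] @ map star_of d) [Zg]" by (rule cu_zero_mid)
  show ?thesis
  proof (cases "suffix b c \<or> suffix c b")
    case True then show ?thesis using m by (auto simp: ij word_def)
  next
    case False then show ?thesis using cu_trans[OF m] z by (simp add: ij word_def)
  qed
qed

lemma cu_mult_class: "cu_mult (cu_class v) (cu_class w) = cu_class (v @ w)"
proof -
  have eq: "cu_class (a @ b) = cu_class (v @ w)" if "cu_rel v a" "cu_rel w b" for a b
    unfolding cu_class_eq by (rule cu_rel_app[OF cu_sym[OF that(1)] cu_sym[OF that(2)]])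
  have "v \<in> cu_class v" "w \<in> cu_class w" by (simp_all add: cu_class_def cu_refl)
  moreover have "cu_class (a @ b) = cu_class (v @ w)" if "a \<in> cu_class v" "b \<in> cu_class w" for a b
    using that eq by (simp add: cu_class_def)
  ultimately show ?thesis unfolding cu_mult_def by blast
qed

lemma cu_mult_elt: "cu_mult (elt i) (elt j) = (case pmult i j of Some k \<Rightarrow> elt k | None \<Rightarrow> cu_zero)"
  using word_mult[of i j]
  by (auto simp: elt_def cu_zero_def cu_mult_class cu_class_eq[symmetric] split: option.splits)

lemma cu_mult_elt_eq: "cu_mult (elt i) (elt j) = elt k \<longleftrightarrow> pmult i j = Some k"
  using inj_elt elt_ne_zero[of k] by (auto simp: cu_mult_elt inj_eq split: option.splits)

text \<open>Each generator except \<open>Zg\<close> is itself a normal form, so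
  \<open>word_mult\<close> absorbs one more letter on the left at each step.\<close>

lemma word_cases: "cu_rel w [Zg] \<or> (\<exists>i. cu_rel w (word i))"
proof (induction w)
  case Nil
  have "word ([], []) = []" by (simp add: word_def)
  then show ?case by (metis cu_refl)
next
  case (Cons g w)
  have g: "g = Zg \<or> (\<exists>j. [g] = word j)"
  proof (cases g)
    case S1 then show ?thesis by (intro disjI2 exI[of _ "([True], [])"]) (simp add: word_def)
  next
    case S2 then show ?thesis by (intro disjI2 exI[of _ "([False], [])"]) (simp add: word_def)
  next
    case S1s then show ?thesis by (intro disjI2 exI[of _ "([], [True])"]) (simp add: word_def)
  next
    case S2s then show ?thesis by (intro disjI2 exI[of _ "([], [False])"]) (simp add: word_def)
  qed auto
  from Cons consider "cu_rel w [Zg]" | i where "cu_rel w (word i)" by blast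
  then show ?case
  proof cases
    case 1
    then have "cu_rel ([g] @ w) ([g] @ [Zg])" by (intro cu_rel_app cu_refl)
    from cu_trans[OF this cu_zero_right] show ?thesis by simp
  next
    case 2
    from g show ?thesis
    proof (elim disjE exE)
      assume "g = Zg" then show ?thesis using cu_zero_left[of w] by simp
    next
      fix j assume j: "[g] = word j"
      have "cu_rel ([g] @ w) (word j @ word i)" unfolding j by (rule cu_rel_app[OF cu_refl 2])
      from cu_trans[OF this word_mult] show ?thesis by (cases "pmult j i") auto
    qed
  qed
qed

lemma bij_elt: "bij_betw elt UNIV Cu2nz"
proof -
  have "range elt = Cu2nz"
  proof
    show "range elt \<subseteq> Cu2nz" using elt_ne_zero by (auto simp: Cu2nz_def Cu2_def elt_def)
    show "Cu2nz \<subseteq> range elt"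
    proof
      fix s assume "s \<in> Cu2nz"
      then obtain w where "s = cu_class w" "s \<noteq> cu_zero" by (auto simp: Cu2nz_def Cu2_def)
      then show "s \<in> range elt"
        using word_cases[of w] by (auto simp: elt_def cu_zero_def cu_class_eq[symmetric])
    qed
  qed
  then show ?thesis using inj_elt by (simp add: bij_betw_def)
qed

section \<open>Refinement of normal forms and its compatibility with products\<close>

lemma pmult_swap: "pmult (prod.swap j) (prod.swap i) = map_option prod.swap (pmult i j)"
  by (cases i; cases j) (auto simp: suffix_def)

text \<open>Inserting e = s_1 s_1^* + s_2 s_2^* between s_alpha and s_beta^* replaces the normal
  form, modulo the ideal, by the sum of its two children.\<close>

fun child :: "bool \<Rightarrow> ix \<Rightarrow> ix" where "child x (a, b) = (x # a, x # b)"

text \<open>Let \<open>j\<close> stand for s_gamma s_delta^*. If delta is a prefix of alpha, the new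
  letter passes through to the product; if delta = alpha y ..., the child y gives the same product
  and the other child gives zero; for incomparable words all products are zero.\<close>

lemma pmult_child_right:
  "(\<forall>x. pmult j (child x i) = map_option (child x) (pmult j i)) \<or>
   (\<exists>y. pmult j (child y i) = pmult j i \<and> pmult j (child (\<not> y) i) = None)"
proof -
  obtain g d a b where ji: "j = (g, d)" "i = (a, b)" by (cases i, cases j)
  consider (1) a' where "a = a' @ d" | (2) d' y where "d = d' @ y # a"
    | (3) "\<not> suffix d a" "\<not> suffix a d"
  proof (cases "suffix d a")
    case True
    then show ?thesis using that(1) by (auto simp: suffix_def)
  next
    case False
    show ?thesis
    proof (cases "suffix a d")
      case True
      then obtain z where z: "d = z @ a" by (auto simp: suffix_def)
      show ?thesis
      proof (cases z rule: rev_cases)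
        case Nil then show ?thesis using z False by simp
      next
        case (snoc d' y) then show ?thesis using z that(2) by simp
      qed
    qed (use False that(3) in blast)
  qed
  then show ?thesis
  proof cases
    case 1 
    have "suffix d a" "\<And>x. suffix d (x # a)" using 1 by (auto simp: suffix_def)
    then show ?thesis using 1 by (auto simp: ji Suc_diff_le)
  next
    case 2
    have n: "\<not> suffix d a" using 2 by (auto dest: suffix_length_le)
    have s: "suffix a d" using 2 by (auto simp: suffix_def)
    have sy: "suffix (y # a) d" using 2 by (auto simp: suffix_def)
    have sn: "\<not> suffix ((\<not> y) # a) d" using 2 by (auto simp: suffix_def)
    have sn': "\<not> suffix d ((\<not> y) # a)"
    proof
      assume A: "suffix d ((\<not> y) # a)"
      then have "d' = []" using 2 suffix_length_le by fastforce
      with A 2 show False by (auto simp: suffix_def)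
    qed
    have "pmult j (child y i) = pmult j i"
    proof (cases "suffix d (y # a)")
      case True
      then have "d = y # a" using n by (auto simp: suffix_Cons)
      then show ?thesis using n by (simp add: ji suffix_Cons)
    next
      case False
      then show ?thesis unfolding ji child.simps pmult.simps using n s sy by (simp add: 2)
    qed
    moreover have "pmult j (child (\<not> y) i) = None" using sn sn' by (simp add: ji)
    ultimately show ?thesis by blast
  next
    case 3
    have "\<not> suffix d (x # a)" "\<not> suffix (x # a) d" for x
      using 3 by (auto simp: suffix_Cons dest: suffix_ConsD)
    then show ?thesis using 3 by (simp add: ji)
  qed
qed

lemma child_swap: "child x (prod.swap i) = prod.swap (child x i)"
  by (cases i) simp

text \<open>Mirror image of \<open>pmult_child_right\<close> under the involution, which is
  \<open>prod.swap\<close> on normal forms.\<close>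

lemma pmult_child_left:
  "(\<forall>x. pmult (child x i) j = map_option (child x) (pmult i j)) \<or>
   (\<exists>y. pmult (child y i) j = pmult i j \<and> pmult (child (\<not> y) i) j = None)"
proof -
  have sw: "pmult (child x i) j = map_option prod.swap (pmult (prod.swap j) (child x (prod.swap i)))" for x
    by (simp add: pmult_swap option.map_comp o_def child_swap option.map_ident)
  from pmult_child_right[of "prod.swap j" "prod.swap i"] show ?thesis
  proof (elim disjE exE conjE)
    assume "\<forall>x. pmult (prod.swap j) (child x (prod.swap i)) =
      map_option (child x) (pmult (prod.swap j) (prod.swap i))"
    then show ?thesis
      unfolding sw pmult_swap by (cases "pmult i j") (auto simp: child_swap)
  next
    fix y
    assume "pmult (prod.swap j) (child y (prod.swap i)) = pmult (prod.swap j) (prod.swap i)"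
      "pmult (prod.swap j) (child (\<not> y) (prod.swap i)) = None"
    then have "pmult (child y i) j = pmult i j \<and> pmult (child (\<not> y) i) j = None"
      unfolding sw pmult_swap by (cases "pmult i j") auto
    then show ?thesis by blast
  qed
qed

section \<open>Kernel operators on absolutely summable functions\<close>

definition l1 :: "('x \<Rightarrow> complex) \<Rightarrow> bool" where
  "l1 F \<longleftrightarrow> (\<lambda>i. norm (F i)) summable_on UNIV"

definition norm1 :: "('x \<Rightarrow> complex) \<Rightarrow> real" where
  "norm1 F = (\<Sum>\<^sub>\<infinity>i. norm (F i))"

lemma norm1_nonneg: "0 \<le> norm1 F"
  by (simp add: norm1_def infsum_nonneg)

lemma l1_norm_le: "l1 F \<Longrightarrow> norm (F i) \<le> norm1 F"
  using finite_sum_le_infsum[of "\<lambda>i. norm (F i)" UNIV "{i}"] by (simp add: l1_def norm1_def)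

lemma norm1_eq_0: "l1 F \<Longrightarrow> norm1 F = 0 \<longleftrightarrow> F = (\<lambda>i. 0)"
  using l1_norm_le[of F] by (fastforce simp: norm1_def)

lemma l1_add: "l1 F \<Longrightarrow> l1 G \<Longrightarrow> l1 (\<lambda>i. F i + G i)"
  and norm1_add: "l1 F \<Longrightarrow> l1 G \<Longrightarrow> norm1 (\<lambda>i. F i + G i) \<le> norm1 F + norm1 G"
proof -
  assume FG: "l1 F" "l1 G"
  have s: "(\<lambda>i. norm (F i) + norm (G i)) summable_on UNIV"
    using FG by (auto simp: l1_def intro: summable_on_add)
  show 1: "l1 (\<lambda>i. F i + G i)"
    unfolding l1_def by (rule Infinite_Sum.abs_summable_on_comparison_test'[OF s]) (rule norm_triangle_ineq)
  show "norm1 (\<lambda>i. F i + G i) \<le> norm1 F + norm1 G"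
    using FG 1 s unfolding norm1_def l1_def
    by (subst infsum_add[symmetric]) (auto intro!: infsum_mono norm_triangle_ineq)
qed

lemma l1_cmult: "l1 F \<Longrightarrow> l1 (\<lambda>i. c * F i)"
  by (auto simp: l1_def norm_mult intro: summable_on_cmult_right)

lemma norm1_cmult: "norm1 (\<lambda>i. c * F i) = norm c * norm1 F"
  by (simp add: norm1_def norm_mult infsum_cmult_right')

lemma l1_uminus: "l1 (\<lambda>i. - F i) \<longleftrightarrow> l1 F" and norm1_uminus: "norm1 (\<lambda>i. - F i) = norm1 F"
  by (auto simp: l1_def norm1_def)

lemma l1_diff: "l1 F \<Longrightarrow> l1 G \<Longrightarrow> l1 (\<lambda>i. F i - G i)"
  using l1_add[of F "\<lambda>i. - G i"] by (simp add: l1_uminus)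

lemma norm1_diff: "l1 F \<Longrightarrow> l1 G \<Longrightarrow> norm1 (\<lambda>i. F i - G i) \<le> norm1 F + norm1 G"
  using norm1_add[of F "\<lambda>i. - G i"] by (simp add: l1_uminus norm1_uminus)

lemma l1_0: "l1 (\<lambda>i. 0)" and norm1_0: "norm1 (\<lambda>i. 0) = 0"
  by (auto simp: l1_def norm1_def)

lemma l1_sum: "(\<And>j. j \<in> A \<Longrightarrow> l1 (F j)) \<Longrightarrow> l1 (\<lambda>i. \<Sum>j\<in>A. F j i)"
  by (induction A rule: infinite_finite_induct) (auto simp: l1_0 intro: l1_add)

definition basis :: "'x \<Rightarrow> 'x \<Rightarrow> complex" where
  "basis k = (\<lambda>i. if i = k then 1 else 0)"

lemma l1_basis: "l1 (basis k)" and norm1_basis: "norm1 (basis k) = 1"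
proof -
  have "((\<lambda>i. norm (basis k i)) has_sum (\<Sum>i\<in>{k}. norm (basis k i))) UNIV"
    by (rule has_sum_finite_neutralI[where B = "{k}"]) (auto simp: basis_def)
  then have h: "((\<lambda>i. norm (basis k i)) has_sum 1) UNIV" by (simp add: basis_def)
  show "l1 (basis k)" using h by (auto simp: l1_def summable_on_def)
  show "norm1 (basis k) = 1" using h by (simp add: norm1_def infsumI)
qed

lemma l1_bounded_mult:
  assumes "l1 F" and "\<And>i. norm (\<phi> i) \<le> C"
  shows "l1 (\<lambda>i. \<phi> i * F i)" and "norm1 (\<lambda>i. \<phi> i * F i) \<le> C * norm1 F"
proof -
  have s: "(\<lambda>i. C * norm (F i)) summable_on UNIV"
    using assms(1) by (auto simp: l1_def intro: summable_on_cmult_right)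
  have le: "norm (\<phi> i * F i) \<le> C * norm (F i)" for i
    by (simp add: norm_mult assms(2) mult_right_mono)
  show 1: "l1 (\<lambda>i. \<phi> i * F i)"
    unfolding l1_def by (rule Infinite_Sum.abs_summable_on_comparison_test'[OF s le])
  have "norm1 (\<lambda>i. \<phi> i * F i) \<le> (\<Sum>\<^sub>\<infinity>i. C * norm (F i))"
    using 1 s le unfolding norm1_def l1_def by (intro infsum_mono) auto
  then show "norm1 (\<lambda>i. \<phi> i * F i) \<le> C * norm1 F"
    by (simp add: norm1_def infsum_cmult_right')
qed

lemma l1_summable: "l1 F \<Longrightarrow> F summable_on UNIV"
  unfolding l1_def by (rule abs_summable_summable)

lemma l1_infsum_le: "l1 F \<Longrightarrow> norm (\<Sum>\<^sub>\<infinity>i. F i) \<le> norm1 F"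
  unfolding l1_def norm1_def by (rule norm_infsum_bound)

text \<open>The operator between l1 spaces that sends the basis vector at \<open>x\<close> to
  \<open>T x\<close>. Both the convolution and the projection along the ideal have this
  form.\<close>

definition kernel_op :: "('x \<Rightarrow> 'y \<Rightarrow> complex) \<Rightarrow> ('x \<Rightarrow> complex) \<Rightarrow> 'y \<Rightarrow> complex" where
  "kernel_op T a = (\<lambda>y. \<Sum>\<^sub>\<infinity>x. a x * T x y)"

locale l1_kernel =
  fixes T :: "'x \<Rightarrow> 'y \<Rightarrow> complex" and C :: real
  assumes l1_T: "\<And>x. l1 (T x)" and norm1_T: "\<And>x. norm1 (T x) \<le> C"
begin

lemma T_le: "norm (T x y) \<le> C"
  using l1_norm_le[OF l1_T] norm1_T order_trans by blast

lemma l1_slice: "l1 a \<Longrightarrow> l1 (\<lambda>x. a x * T x y)"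
  using l1_bounded_mult(1)[of a "\<lambda>x. T x y" C] T_le by (simp add: mult.commute)

text \<open>This permits every exchange of the sums over \<open>x\<close> and \<open>y\<close>
  below.\<close>

lemma abs_summable_prod:
  assumes "l1 a" shows "(\<lambda>z. norm (case z of (x, y) \<Rightarrow> a x * T x y)) summable_on UNIV \<times> UNIV"
  unfolding Infinite_Sum.abs_summable_on_Sigma_iff
proof (intro conjI ballI)
  fix x show "(\<lambda>y. norm (case (x, y) of (x, y) \<Rightarrow> a x * T x y)) summable_on UNIV"
    using l1_cmult[OF l1_T, of "a x" x] by (simp add: l1_def)
next
  have "l1 (\<lambda>x. of_real (norm1 (T x)) * a x)"
    by (rule l1_bounded_mult(1)[OF assms, of _ C]) (simp add: norm1_T norm1_nonneg)
  then have "(\<lambda>x. norm (norm1 (\<lambda>y. a x * T x y))) summable_on UNIV"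
    by (simp add: l1_def norm_mult norm1_cmult norm1_nonneg mult.commute)
  then show "(\<lambda>x. norm (\<Sum>\<^sub>\<infinity>y. norm (case (x, y) of (x, y) \<Rightarrow> a x * T x y))) summable_on UNIV"
    by (simp add: norm1_def)
qed

lemma kernel_op_l1: "l1 a \<Longrightarrow> l1 (kernel_op T a)"
  and kernel_op_norm1: "l1 a \<Longrightarrow> norm1 (kernel_op T a) \<le> C * norm1 a"
proof -
  assume a: "l1 a"
  have s: "(\<lambda>(x, y). norm (a x * T x y)) summable_on UNIV \<times> UNIV"
    using abs_summable_prod[OF a] by (simp add: case_prod_unfold)
  then have s': "(\<lambda>(y, x). norm (a x * T x y)) summable_on UNIV \<times> UNIV"
    using summable_on_swap[of "\<lambda>(x, y). norm (a x * T x y)" UNIV UNIV]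
    by (simp add: case_prod_unfold prod.swap_def)
  have sy: "(\<lambda>y. norm1 (\<lambda>x. a x * T x y)) summable_on UNIV"
    using summable_on_Sigma_banach[of "\<lambda>y x. norm (a x * T x y)" UNIV "\<lambda>_. UNIV"] s'
    by (simp add: norm1_def case_prod_unfold)
  have le: "norm (kernel_op T a y) \<le> norm1 (\<lambda>x. a x * T x y)" for y
    unfolding kernel_op_def by (rule l1_infsum_le[OF l1_slice[OF a]])
  show 1: "l1 (kernel_op T a)"
    unfolding l1_def by (rule Infinite_Sum.abs_summable_on_comparison_test'[OF sy le])
  have "norm1 (kernel_op T a) \<le> (\<Sum>\<^sub>\<infinity>y. norm1 (\<lambda>x. a x * T x y))"
    using 1 sy le unfolding norm1_def[of "kernel_op T a"] l1_def by (intro infsum_mono) auto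
  also have "\<dots> = (\<Sum>\<^sub>\<infinity>x. norm1 (\<lambda>y. a x * T x y))"
    unfolding norm1_def by (rule infsum_swap_banach[OF s', unfolded])
  also have "\<dots> = norm1 (\<lambda>x. of_real (norm1 (T x)) * a x)"
    unfolding norm1_cmult norm1_def[of "\<lambda>x. of_real (norm1 (T x)) * a x"]
    by (simp add: norm_mult norm1_nonneg mult.commute)
  also have "\<dots> \<le> C * norm1 a"
    by (rule l1_bounded_mult(2)[OF a]) (simp add: norm1_T norm1_nonneg)
  finally show "norm1 (kernel_op T a) \<le> C * norm1 a" .
qed

lemma kernel_op_add: "l1 a \<Longrightarrow> l1 b \<Longrightarrow> kernel_op T (\<lambda>x. a x + b x) = (\<lambda>y. kernel_op T a y + kernel_op T b y)"
  unfolding kernel_op_def by (simp add: distrib_right infsum_add l1_summable l1_slice)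

lemma kernel_op_cmult: "kernel_op T (\<lambda>x. c * a x) = (\<lambda>y. c * kernel_op T a y)"
  unfolding kernel_op_def by (simp add: mult.assoc infsum_cmult_right')

lemma kernel_op_diff: "l1 a \<Longrightarrow> l1 b \<Longrightarrow> kernel_op T (\<lambda>x. a x - b x) = (\<lambda>y. kernel_op T a y - kernel_op T b y)"
  using kernel_op_add[of a "\<lambda>x. - 1 * b x"] kernel_op_cmult[of "-1" b] l1_cmult[of b "-1"] by simp

lemma kernel_op_basis: "kernel_op T (basis x) = T x"
proof
  fix y
  have "((\<lambda>x'. basis x x' * T x' y) has_sum (\<Sum>x'\<in>{x}. basis x x' * T x' y)) UNIV"
    by (rule has_sum_finite_neutralI[where B = "{x}"]) (auto simp: basis_def)
  then show "kernel_op T (basis x) y = T x y" by (simp add: kernel_op_def infsumI basis_def)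
qed

lemma kernel_op_sum:
  "(\<And>j. j \<in> A \<Longrightarrow> l1 (F j)) \<Longrightarrow> kernel_op T (\<lambda>x. \<Sum>j\<in>A. F j x) = (\<lambda>y. \<Sum>j\<in>A. kernel_op T (F j) y)"
  by (induction A rule: infinite_finite_induct)
    (auto simp: kernel_op_add l1_sum kernel_op_cmult[of 0 "\<lambda>x. 0", simplified])

lemma kernel_op_pairing:
  assumes a: "l1 a" and \<phi>: "\<And>y. norm (\<phi> y) \<le> D"
  shows "(\<Sum>\<^sub>\<infinity>y. \<phi> y * kernel_op T a y) = (\<Sum>\<^sub>\<infinity>x. a x * (\<Sum>\<^sub>\<infinity>y. \<phi> y * T x y))"
proof -
  have "l1 (\<lambda>z. \<phi> (snd z) * (a (fst z) * T (fst z) (snd z)))"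
    by (rule l1_bounded_mult(1)) (use abs_summable_prod[OF a] \<phi> in \<open>auto simp: l1_def case_prod_unfold\<close>)
  then have s: "(\<lambda>(x, y). \<phi> y * (a x * T x y)) summable_on UNIV \<times> UNIV"
    by (auto dest: l1_summable simp: case_prod_unfold)
  have "(\<Sum>\<^sub>\<infinity>y. \<phi> y * kernel_op T a y) = (\<Sum>\<^sub>\<infinity>y. \<Sum>\<^sub>\<infinity>x. \<phi> y * (a x * T x y))"
    by (simp add: kernel_op_def infsum_cmult_right')
  also have "\<dots> = (\<Sum>\<^sub>\<infinity>x. \<Sum>\<^sub>\<infinity>y. \<phi> y * (a x * T x y))"
    using infsum_swap_banach[OF s] by simp
  also have "\<dots> = (\<Sum>\<^sub>\<infinity>x. a x * (\<Sum>\<^sub>\<infinity>y. \<phi> y * T x y))"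
    by (simp add: mult.left_commute[of _ "a _"] infsum_cmult_right')
  finally show ?thesis .
qed

end

lemma l1_tensor:
  assumes "l1 F" "l1 G"
  shows "l1 (\<lambda>z. F (fst z) * G (snd z))" "norm1 (\<lambda>z. F (fst z) * G (snd z)) = norm1 F * norm1 G"
proof -
  interpret l1_kernel "\<lambda>_. G" "norm1 G" by standard (auto simp: assms)
  have s: "(\<lambda>z. norm (case z of (x, y) \<Rightarrow> F x * G y)) summable_on UNIV \<times> UNIV" by (rule abs_summable_prod[OF assms(1)])
  then show "l1 (\<lambda>z. F (fst z) * G (snd z))" by (simp add: l1_def case_prod_unfold)
  have s': "(\<lambda>(x, y). norm (F x * G y)) summable_on UNIV \<times> UNIV"
    using s by (simp add: case_prod_unfold)
  have "norm1 (\<lambda>z. F (fst z) * G (snd z)) = (\<Sum>\<^sub>\<infinity>(x, y)\<in>UNIV \<times> UNIV. norm (F x * G y))"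
    by (simp add: norm1_def case_prod_unfold)
  also have "\<dots> = (\<Sum>\<^sub>\<infinity>x. \<Sum>\<^sub>\<infinity>y. norm (F x * G y))"
    by (rule infsum_Sigma'_banach[symmetric, OF s'])
  also have "\<dots> = norm1 F * norm1 G"
    by (simp add: norm_mult infsum_cmult_right' infsum_cmult_left' norm1_def)
  finally show "norm1 (\<lambda>z. F (fst z) * G (snd z)) = norm1 F * norm1 G" .
qed

lemma l1_finite_approx:
  assumes "l1 F" "e > 0"
  obtains A where "finite A" "norm1 (\<lambda>i. F i - (\<Sum>j\<in>A. F j * basis j i)) < e"
proof -
  have s: "(\<lambda>i. norm (F i)) summable_on UNIV" using assms(1) by (simp add: l1_def)
  obtain A where A: "finite A" "dist (\<Sum>i\<in>A. norm (F i)) (norm1 F) \<le> e/2"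
    using infsum_finite_approximation[OF s, of "e/2"] assms(2) by (auto simp: norm1_def)
  have eq: "F i - (\<Sum>j\<in>A. F j * basis j i) = (if i \<in> A then 0 else F i)" for i
  proof -
    have "(\<Sum>j\<in>A. F j * basis j i) = (\<Sum>j\<in>A. if j = i then F j else 0)"
      by (rule sum.cong) (auto simp: basis_def)
    then show ?thesis using A(1) by simp
  qed
  have "norm1 (\<lambda>i. F i - (\<Sum>j\<in>A. F j * basis j i)) = (\<Sum>\<^sub>\<infinity>i\<in>-A. norm (F i))"
    unfolding norm1_def eq by (rule infsum_cong_neutral) auto
  also have "\<dots> = norm1 F - (\<Sum>i\<in>A. norm (F i))"
  proof -
    have "norm1 F = (\<Sum>\<^sub>\<infinity>i\<in>A \<union> - A. norm (F i))" by (simp add: norm1_def)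
    also have "\<dots> = (\<Sum>i\<in>A. norm (F i)) + (\<Sum>\<^sub>\<infinity>i\<in>-A. norm (F i))"
      using A(1) summable_on_subset_banach[OF s] by (subst infsum_Un_disjoint) auto
    finally show ?thesis by simp
  qed
  also have "\<dots> \<le> dist (\<Sum>i\<in>A. norm (F i)) (norm1 F)" by (simp add: dist_real_def)
  also have "\<dots> \<le> e / 2" by (rule A(2))
  also have "\<dots> < e" using assms(2) by simp
  finally show ?thesis using A(1) that by blast
qed

section \<open>The quotient as a complemented subspace\<close>

definition of_coords :: "(ix \<Rightarrow> complex) \<Rightarrow> gen list set \<Rightarrow> complex" where
  "of_coords F s = (if s \<in> Cu2nz then F (inv elt s) else 0)"

definition coords :: "(gen list set \<Rightarrow> complex) \<Rightarrow> ix \<Rightarrow> complex" where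
  "coords f i = f (elt i)"

lemma elt_Cu2nz: "elt i \<in> Cu2nz"
  using bij_elt by (auto simp: bij_betw_def)

lemma Cu2nzE: "s \<in> Cu2nz \<Longrightarrow> (\<And>i. s = elt i \<Longrightarrow> P) \<Longrightarrow> P"
  using bij_elt unfolding bij_betw_def by blast

lemma coords_of_coords: "coords (of_coords F) = F"
  by (simp add: coords_def of_coords_def fun_eq_iff elt_Cu2nz inj_elt)

lemma of_coords_coords: "f \<in> ell1 \<Longrightarrow> of_coords (coords f) = f"
proof
  fix s assume f: "f \<in> ell1"
  show "of_coords (coords f) s = f s"
  proof (cases "s \<in> Cu2nz")
    case True
    then obtain i where "s = elt i" by (rule Cu2nzE)
    then show ?thesis using True by (simp add: of_coords_def coords_def inj_elt)
  qed (use f in \<open>auto simp: of_coords_def ell1_def\<close>)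
qed

lemma ell1_iff: "f \<in> ell1 \<longleftrightarrow> (\<forall>s. s \<notin> Cu2nz \<longrightarrow> f s = 0) \<and> l1 (coords f)"
  using summable_on_reindex_bij_betw[OF bij_elt, of "\<lambda>s. norm (f s)"]
  by (simp add: ell1_def l1_def coords_def)

lemma ell1_l1: "f \<in> ell1 \<Longrightarrow> l1 (coords f)"
  by (simp add: ell1_iff)

lemma of_coords_ell1: "l1 F \<Longrightarrow> of_coords F \<in> ell1"
  by (simp add: ell1_iff coords_of_coords) (simp add: of_coords_def)

lemma l1norm_coords: "l1norm f = norm1 (coords f)"
  using infsum_reindex_bij_betw[OF bij_elt, of "\<lambda>s. norm (f s)"]
  by (simp add: l1norm_def norm1_def coords_def)

lemma coords_add: "coords (\<lambda>s. f s + g s) = (\<lambda>i. coords f i + coords g i)"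
  and coords_diff: "coords (\<lambda>s. f s - g s) = (\<lambda>i. coords f i - coords g i)"
  and coords_cmult: "coords (\<lambda>s. c * f s) = (\<lambda>i. c * coords f i)"
  by (auto simp: coords_def)

lemma ell1_add: "f \<in> ell1 \<Longrightarrow> g \<in> ell1 \<Longrightarrow> (\<lambda>s. f s + g s) \<in> ell1"
  and ell1_diff: "f \<in> ell1 \<Longrightarrow> g \<in> ell1 \<Longrightarrow> (\<lambda>s. f s - g s) \<in> ell1"
  and ell1_cmult: "f \<in> ell1 \<Longrightarrow> (\<lambda>s. c * f s) \<in> ell1"
  by (auto simp: ell1_iff coords_add coords_diff coords_cmult l1_add l1_diff l1_cmult)

section \<open>The product in coordinates\<close>

definition mult_kernel :: "ix \<times> ix \<Rightarrow> ix \<Rightarrow> complex" where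
  "mult_kernel z = (case pmult (fst z) (snd z) of Some k \<Rightarrow> basis k | None \<Rightarrow> (\<lambda>_. 0))"

interpretation mult_kernel: l1_kernel mult_kernel 1
  by standard (auto simp: mult_kernel_def l1_basis l1_0 norm1_basis norm1_0 split: option.split)

text \<open>Convolution as a linear operator on the l1 space of pairs, applied to the tensor
  product. A product of basis vectors is a basis vector or 0, whence the kernel bound 1 and the
  submultiplicative norm.\<close>

definition pconv :: "(ix \<Rightarrow> complex) \<Rightarrow> (ix \<Rightarrow> complex) \<Rightarrow> ix \<Rightarrow> complex" where
  "pconv F G = kernel_op mult_kernel (\<lambda>z. F (fst z) * G (snd z))"

lemma coords_conv: "coords (conv f g) = pconv (coords f) (coords g)"
proof
  fix k
  define A where "A = {z. pmult (fst z) (snd z) = Some k}"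
  have A: "{(s, t). s \<in> Cu2nz \<and> t \<in> Cu2nz \<and> cu_mult s t = elt k} = map_prod elt elt ` A"
  proof (intro set_eqI iffI)
    fix z assume "z \<in> {(s, t). s \<in> Cu2nz \<and> t \<in> Cu2nz \<and> cu_mult s t = elt k}"
    then obtain s t where z: "z = (s, t)" "s \<in> Cu2nz" "t \<in> Cu2nz" "cu_mult s t = elt k" by auto
    then obtain i j where "s = elt i" "t = elt j" by (meson Cu2nzE)
    with z have "z = map_prod elt elt (i, j)" "(i, j) \<in> A" by (auto simp: A_def cu_mult_elt_eq)
    then show "z \<in> map_prod elt elt ` A" by blast
  next
    fix z assume "z \<in> map_prod elt elt ` A"
    then obtain w where w: "z = map_prod elt elt w" "w \<in> A" by (rule imageE)
    define i j where "i = fst w" and "j = snd w"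
    have z: "z = (elt i, elt j)" "pmult i j = Some k"
      using w by (auto simp: A_def i_def j_def map_prod_def case_prod_unfold simp del: pmult.simps)
    show "z \<in> {(s, t). s \<in> Cu2nz \<and> t \<in> Cu2nz \<and> cu_mult s t = elt k}"
      unfolding z(1) using elt_Cu2nz[of i] elt_Cu2nz[of j] cu_mult_elt_eq[THEN iffD2, OF z(2)]
      by blast
  qed
  have inj: "inj_on (map_prod elt elt) A"
    by (rule inj_on_subset[OF prod.inj_map[OF inj_elt inj_elt]]) simp
  have "coords (conv f g) k = (\<Sum>\<^sub>\<infinity>(s, t)\<in>map_prod elt elt ` A. f s * g t)"
    by (simp add: coords_def conv_def elt_Cu2nz A)
  also have "\<dots> = (\<Sum>\<^sub>\<infinity>z\<in>A. coords f (fst z) * coords g (snd z))"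
    by (simp add: infsum_reindex[OF inj] o_def coords_def case_prod_unfold)
  also have "\<dots> = (\<Sum>\<^sub>\<infinity>z. coords f (fst z) * coords g (snd z) * mult_kernel z k)"
    by (rule infsum_cong_neutral) (auto simp: A_def mult_kernel_def basis_def split: option.splits)
  finally show "coords (conv f g) k = pconv (coords f) (coords g) k" by (simp add: pconv_def kernel_op_def)
qed

lemma l1_pconv: "l1 F \<Longrightarrow> l1 G \<Longrightarrow> l1 (pconv F G)"
  unfolding pconv_def by (intro mult_kernel.kernel_op_l1 l1_tensor)

lemma norm1_pconv: "l1 F \<Longrightarrow> l1 G \<Longrightarrow> norm1 (pconv F G) \<le> norm1 F * norm1 G"
  unfolding pconv_def using mult_kernel.kernel_op_norm1[OF l1_tensor(1)] l1_tensor(2) by fastforce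

lemma conv_ell1: "f \<in> ell1 \<Longrightarrow> g \<in> ell1 \<Longrightarrow> conv f g \<in> ell1"
  by (simp add: ell1_iff coords_conv l1_pconv) (simp add: conv_def)

lemma pconv_diff_left: "l1 F \<Longrightarrow> l1 G \<Longrightarrow> l1 H \<Longrightarrow> pconv (\<lambda>i. F i - G i) H = (\<lambda>k. pconv F H k - pconv G H k)"
  unfolding pconv_def by (subst mult_kernel.kernel_op_diff[symmetric]) (auto simp: l1_tensor left_diff_distrib)

lemma pconv_diff_right: "l1 F \<Longrightarrow> l1 G \<Longrightarrow> l1 H \<Longrightarrow> pconv F (\<lambda>i. G i - H i) = (\<lambda>k. pconv F G k - pconv F H k)"
  unfolding pconv_def by (subst mult_kernel.kernel_op_diff[symmetric]) (auto simp: l1_tensor right_diff_distrib)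

lemma pconv_basis: "pconv (basis i) (basis j) = mult_kernel (i, j)"
proof -
  have "(\<lambda>z. basis i (fst z) * basis j (snd z)) = basis (i, j)"
    by (auto simp: basis_def fun_eq_iff)
  then show ?thesis by (simp add: pconv_def mult_kernel.kernel_op_basis)
qed

section \<open>Functionals that vanish on the ideal\<close>

definition pair :: "('x \<Rightarrow> complex) \<Rightarrow> ('x \<Rightarrow> complex) \<Rightarrow> complex" where
  "pair \<phi> F = (\<Sum>\<^sub>\<infinity>i. \<phi> i * F i)"

lemma pair_add: "l1 F \<Longrightarrow> l1 G \<Longrightarrow> (\<And>i. norm (\<phi> i) \<le> C) \<Longrightarrow>
    pair \<phi> (\<lambda>i. F i + G i) = pair \<phi> F + pair \<phi> G"
  unfolding pair_def distrib_left
  by (intro infsum_add l1_summable l1_bounded_mult(1)) auto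

lemma pair_cmult: "pair \<phi> (\<lambda>i. c * F i) = c * pair \<phi> F"
  by (simp add: pair_def mult.left_commute[of _ c] infsum_cmult_right')

lemma pair_diff: "l1 F \<Longrightarrow> l1 G \<Longrightarrow> (\<And>i. norm (\<phi> i) \<le> C) \<Longrightarrow>
    pair \<phi> (\<lambda>i. F i - G i) = pair \<phi> F - pair \<phi> G"
  using pair_add[of F "\<lambda>i. - 1 * G i" \<phi> C] pair_cmult[of \<phi> "-1" G] l1_cmult[of G "-1"] by simp

lemma pair_le: "l1 F \<Longrightarrow> (\<And>i. norm (\<phi> i) \<le> C) \<Longrightarrow> norm (pair \<phi> F) \<le> C * norm1 F"
  unfolding pair_def using l1_infsum_le l1_bounded_mult order_trans by metis

lemma pair_basis: "pair \<phi> (basis k) = \<phi> k"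
proof -
  have "((\<lambda>i. \<phi> i * basis k i) has_sum (\<Sum>i\<in>{k}. \<phi> i * basis k i)) UNIV"
    by (rule has_sum_finite_neutralI[where B = "{k}"]) (auto simp: basis_def)
  then show ?thesis by (simp add: pair_def infsumI basis_def)
qed

text \<open>These are the bounded functionals on \<open>\<ell>\<^sup>1\<close> that vanish on the ideal. They are stable under
  translation by monoid elements, so their common kernel is an ideal.\<close>

definition additive :: "(ix \<Rightarrow> complex) \<Rightarrow> bool" where
  "additive \<phi> \<longleftrightarrow> (\<exists>C. \<forall>i. norm (\<phi> i) \<le> C) \<and> (\<forall>i. \<phi> i = \<phi> (child True i) + \<phi> (child False i))"

definition annih :: "(ix \<Rightarrow> complex) \<Rightarrow> bool" where
  "annih F \<longleftrightarrow> l1 F \<and> (\<forall>\<phi>. additive \<phi> \<longrightarrow> pair \<phi> F = 0)"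

text \<open>The extension of \<open>\<phi>\<close> by 0 to the zero of the monoid. With
  \<open>pmult i j\<close> as argument it is a translate of \<open>\<phi>\<close>, by
  \<open>i\<close> on the left or by \<open>j\<close> on the right.\<close>

definition pull :: "(ix \<Rightarrow> complex) \<Rightarrow> ix option \<Rightarrow> complex" where
  "pull \<phi> z = (case z of Some k \<Rightarrow> \<phi> k | None \<Rightarrow> 0)"

lemma pull_le:
  assumes "\<And>i. norm (\<phi> i) \<le> C" shows "norm (pull \<phi> z) \<le> C"
  using assms order_trans[OF norm_ge_zero assms[of "([], [])"]] by (cases z) (auto simp: pull_def)

text \<open>\<open>m\<close> stands for a translation on either side. If it maps children to
  children, additivity is inherited from \<open>\<phi>\<close>; otherwise one child carries the
  whole value and the other contributes 0.\<close>

lemma additive_pull: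
  assumes "additive \<phi>"
    and "\<And>i. (\<forall>x. m (child x i) = map_option (child x) (m i)) \<or>
      (\<exists>y. m (child y i) = m i \<and> m (child (\<not> y) i) = None)"
  shows "additive (\<lambda>i. pull \<phi> (m i))"
  unfolding additive_def
proof (intro conjI allI)
  show "\<exists>C. \<forall>i. norm (pull \<phi> (m i)) \<le> C" using assms(1) pull_le unfolding additive_def by metis
next
  fix i
  from assms(2)[of i]
  show "pull \<phi> (m i) = pull \<phi> (m (child True i)) + pull \<phi> (m (child False i))"
  proof (elim disjE exE conjE)
    assume h: "\<forall>x. m (child x i) = map_option (child x) (m i)"
    have e: "\<phi> k = \<phi> (child True k) + \<phi> (child False k)" for k
      using assms(1) unfolding additive_def by blast
    show ?thesis
    proof (cases "m i")
      case (Some k) then show ?thesis using h e[of k] by (simp add: pull_def)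
    qed (use h in \<open>simp add: pull_def\<close>)
  next
    fix y assume "m (child y i) = m i" "m (child (\<not> y) i) = None"
    then show ?thesis by (cases y) (auto simp: pull_def)
  qed
qed

text \<open>The double sum taken in its two orders: the inner sum is a translate of
  \<open>\<phi>\<close> paired with one of the factors.\<close>

lemma pair_pconv:
  assumes "l1 F" "l1 G" "\<And>i. norm (\<phi> i) \<le> C"
  shows "pair \<phi> (pconv F G) = (\<Sum>\<^sub>\<infinity>i. F i * pair (\<lambda>j. pull \<phi> (pmult i j)) G)"
    and "pair \<phi> (pconv F G) = (\<Sum>\<^sub>\<infinity>j. G j * pair (\<lambda>i. pull \<phi> (pmult i j)) F)"
proof -
  have "pair \<phi> (mult_kernel z) = pull \<phi> (pmult (fst z) (snd z))" for z
    by (simp add: mult_kernel_def pull_def pair_basis pair_cmult[of \<phi> 0, simplified] split: option.split)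
  then have e: "pair \<phi> (pconv F G) = (\<Sum>\<^sub>\<infinity>z. F (fst z) * G (snd z) * pull \<phi> (pmult (fst z) (snd z)))"
    using mult_kernel.kernel_op_pairing[OF l1_tensor(1)[OF assms(1,2)] assms(3)] by (simp add: pconv_def pair_def)
  have "l1 (\<lambda>z. pull \<phi> (pmult (fst z) (snd z)) * (F (fst z) * G (snd z)))"
    by (rule l1_bounded_mult(1)[OF l1_tensor(1)[OF assms(1,2)] pull_le[OF assms(3)]])
  then have s: "(\<lambda>(i, j). F i * G j * pull \<phi> (pmult i j)) summable_on UNIV \<times> UNIV"
    by (auto dest!: l1_summable simp: case_prod_unfold mult.commute)
  have 1: "pair \<phi> (pconv F G) = (\<Sum>\<^sub>\<infinity>i. \<Sum>\<^sub>\<infinity>j. F i * G j * pull \<phi> (pmult i j))"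
    unfolding e using infsum_Sigma'_banach[OF s] by (simp add: case_prod_unfold)
  then show "pair \<phi> (pconv F G) = (\<Sum>\<^sub>\<infinity>i. F i * pair (\<lambda>j. pull \<phi> (pmult i j)) G)"
    by (simp add: pair_def infsum_cmult_right' mult.assoc mult.commute[of "G _"])
  have "pair \<phi> (pconv F G) = (\<Sum>\<^sub>\<infinity>j. \<Sum>\<^sub>\<infinity>i. F i * G j * pull \<phi> (pmult i j))"
    unfolding 1 by (rule infsum_swap_banach[OF s])
  also have "\<dots> = (\<Sum>\<^sub>\<infinity>j. \<Sum>\<^sub>\<infinity>i. G j * (pull \<phi> (pmult i j) * F i))"
    by (intro infsum_cong) (simp add: mult_ac)
  finally show "pair \<phi> (pconv F G) = (\<Sum>\<^sub>\<infinity>j. G j * pair (\<lambda>i. pull \<phi> (pmult i j)) F)"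
    by (simp add: pair_def infsum_cmult_right')
qed

text \<open>Translates of additive functionals are additive, so every inner pairing in
  \<open>pair_pconv\<close> is 0.\<close>

lemma annih_pconv:
  assumes "l1 A" "annih F" shows "annih (pconv A F)" "annih (pconv F A)"
proof -
  have F: "l1 F" using assms(2) by (simp add: annih_def)
  have "pair \<phi> (pconv A F) = 0 \<and> pair \<phi> (pconv F A) = 0" if \<phi>: "additive \<phi>" for \<phi>
  proof -
    obtain C where C: "\<And>i. norm (\<phi> i) \<le> C" using \<phi> unfolding additive_def by blast
    have "pair (\<lambda>j. pull \<phi> (pmult i j)) F = 0" "pair (\<lambda>j. pull \<phi> (pmult j i)) F = 0" for i
      using assms(2) additive_pull[OF \<phi> pmult_child_right] additive_pull[OF \<phi> pmult_child_left]
      by (auto simp: annih_def)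
    then show ?thesis using pair_pconv(1)[OF assms(1) F C] pair_pconv(2)[OF F assms(1) C] by simp
  qed
  then show "annih (pconv A F)" "annih (pconv F A)" using assms(1) F by (auto simp: annih_def l1_pconv)
qed

lemma coords_delta: "coords (delta (elt k)) = basis k"
  using inj_elt by (auto simp: coords_def delta_def basis_def inj_eq)

text \<open>The coordinates of s_alpha f0 s_beta^*.\<close>

definition rel :: "ix \<Rightarrow> ix \<Rightarrow> complex" where
  "rel i = (\<lambda>k. basis i k - basis (child True i) k - basis (child False i) k)"

lemma l1_rel: "l1 (rel i)"
  unfolding rel_def by (intro l1_diff l1_basis)

lemma coords_f0: "coords f0 = rel ([], [])"
proof -
  have e: "cu_e = elt ([], [])" "cu_class [S1, S1s] = elt ([True], [True])"
    "cu_class [S2, S2s] = elt ([False], [False])"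
    by (auto simp: cu_e_def elt_def word_def)
  show ?thesis unfolding f0_def e coords_diff coords_delta by (simp add: rel_def)
qed

lemma f0_ell1: "f0 \<in> ell1"
proof -
  have "f0 s = 0" if "s \<notin> Cu2nz" for s
  proof -
    have "cu_e \<in> Cu2nz" "cu_class [S1, S1s] \<in> Cu2nz" "cu_class [S2, S2s] \<in> Cu2nz"
      using elt_Cu2nz[of "([], [])"] elt_Cu2nz[of "([True], [True])"] elt_Cu2nz[of "([False], [False])"]
      by (auto simp: cu_e_def elt_def word_def)
    then show ?thesis using that by (auto simp: f0_def delta_def)
  qed
  then show ?thesis by (simp add: ell1_iff coords_f0 l1_rel)
qed

lemma annih_rel: "annih (rel i)"
proof -
  have "pair \<phi> (rel i) = 0" if \<phi>: "additive \<phi>" for \<phi>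
  proof -
    obtain C where C: "\<And>i. norm (\<phi> i) \<le> C" using \<phi> unfolding additive_def by blast
    have "pair \<phi> (rel i) = \<phi> i - \<phi> (child True i) - \<phi> (child False i)"
      unfolding rel_def by (simp add: pair_diff[OF _ _ C] l1_diff l1_basis pair_basis)
    moreover have "\<phi> i = \<phi> (child True i) + \<phi> (child False i)"
      using \<phi> unfolding additive_def by blast
    ultimately show ?thesis by simp
  qed
  then show ?thesis by (simp add: annih_def l1_rel)
qed

text \<open>Stability under products is \<open>annih_pconv\<close>; closedness holds because each
  additive functional is bounded on l1.\<close>

lemma closed_ideal_annih: "is_closed_ideal {f \<in> ell1. annih (coords f)}"
  unfolding is_closed_ideal_def
proof (intro conjI ballI allI impI)
  fix f g assume "f \<in> {f \<in> ell1. annih (coords f)}" "g \<in> {f \<in> ell1. annih (coords f)}"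
  then have fg: "f \<in> ell1" "g \<in> ell1" "annih (coords f)" "annih (coords g)" by auto
  have "pair \<phi> (\<lambda>i. coords f i + coords g i) = 0" if \<phi>: "additive \<phi>" for \<phi>
  proof -
    obtain C where C: "\<And>i. norm (\<phi> i) \<le> C" using \<phi> unfolding additive_def by blast
    show ?thesis
      using pair_add[OF ell1_l1[OF fg(1)] ell1_l1[OF fg(2)] C] fg(3,4) \<phi> by (simp add: annih_def)
  qed
  then show "(\<lambda>s. f s + g s) \<in> {f \<in> ell1. annih (coords f)}"
    using fg by (simp add: ell1_add coords_add annih_def l1_add)
next
  fix f c assume "f \<in> {f \<in> ell1. annih (coords f)}"
  then show "(\<lambda>s. c * f s) \<in> {f \<in> ell1. annih (coords f)}"
    by (auto simp: ell1_cmult coords_cmult annih_def l1_cmult pair_cmult)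
next
  fix a f assume "a \<in> ell1" "f \<in> {f \<in> ell1. annih (coords f)}"
  then show "conv a f \<in> {f \<in> ell1. annih (coords f)}" "conv f a \<in> {f \<in> ell1. annih (coords f)}"
    by (auto simp: conv_ell1 coords_conv annih_pconv ell1_l1)
next
  fix f assume f: "f \<in> ell1" and app: "\<forall>e>0. \<exists>g\<in>{f \<in> ell1. annih (coords f)}. l1norm (\<lambda>s. f s - g s) < e"
  have "pair \<phi> (coords f) = 0" if \<phi>: "additive \<phi>" for \<phi>
  proof (rule ccontr)
    assume n: "pair \<phi> (coords f) \<noteq> 0"
    obtain C0 where C0: "\<And>i. norm (\<phi> i) \<le> C0" using \<phi> unfolding additive_def by blast
    define C where "C = max C0 1"
    have C: "norm (\<phi> i) \<le> C" for i using C0[of i] by (simp add: C_def)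
    have C1: "C > 0" by (simp add: C_def)
    have "norm (pair \<phi> (coords f)) / C > 0" using n C1 by simp
    with app obtain g where g: "g \<in> ell1" "annih (coords g)" "l1norm (\<lambda>s. f s - g s) < norm (pair \<phi> (coords f)) / C"
      by blast
    have "pair \<phi> (coords f) = pair \<phi> (\<lambda>i. coords f i - coords g i)"
      using pair_diff[OF ell1_l1[OF f] ell1_l1[OF g(1)] C] g(2) \<phi> by (simp add: annih_def)
    also have "norm \<dots> \<le> C * norm1 (\<lambda>i. coords f i - coords g i)"
      by (rule pair_le[OF l1_diff[OF ell1_l1[OF f] ell1_l1[OF g(1)]] C])
    also have "\<dots> < norm (pair \<phi> (coords f))"
      using g(3) C1 by (simp add: l1norm_coords coords_diff field_simps)
    finally show False by simp
  qed
  then show "f \<in> {f \<in> ell1. annih (coords f)}" using f by (simp add: annih_def ell1_l1)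
qed auto

lemma J_annih: "f \<in> J \<Longrightarrow> f \<in> ell1 \<and> annih (coords f)"
proof -
  have "f0 \<in> {f \<in> ell1. annih (coords f)}" by (simp add: f0_ell1 coords_f0 annih_rel)
  then have "J \<subseteq> {f \<in> ell1. annih (coords f)}" unfolding J_def using closed_ideal_annih by blast
  then show "f \<in> J \<Longrightarrow> f \<in> ell1 \<and> annih (coords f)" by blast
qed

text \<open>The projection of \<open>\<ell>\<^sup>1\<close> along the closed span of the relations \<open>rel i\<close>.
  Its dual solves \<open>\<phi> i = \<phi> (child True i) + \<phi> (child False i)\<close> by halving at each step.\<close>

fun proj_kernel :: "ix \<Rightarrow> ix \<Rightarrow> complex" where
  "proj_kernel (x # a, y # b) = (if x = y
     then (\<lambda>k. (1/2) * (basis (x # a, x # b) k - basis ((\<not> x) # a, (\<not> x) # b) k) + (1/2) * proj_kernel (a, b) k)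
     else basis (x # a, y # b))"
| "proj_kernel i = basis i"

text \<open>The bound 2 reproduces itself: half of a difference of two basis vectors has norm at
  most 1, and so has half of the previous value.\<close>

lemma proj_kernel_l1_norm1: "l1 (proj_kernel i) \<and> norm1 (proj_kernel i) \<le> 2"
proof (induction i rule: proj_kernel.induct)
  case (1 x a y b)
  show ?case
  proof (cases "x = y")
    case True
    let ?d = "\<lambda>k. basis (x # a, x # b) k - basis ((\<not> x) # a, (\<not> x) # b) k"
    have d: "l1 ?d" by (intro l1_diff l1_basis)
    have d2: "norm1 ?d \<le> 2"
      using norm1_diff[OF l1_basis l1_basis, of "(x # a, x # b)" "((\<not> x) # a, (\<not> x) # b)"]
      by (simp add: norm1_basis)
    have e: "proj_kernel (x # a, y # b) = (\<lambda>k. (1/2) * ?d k + (1/2) * proj_kernel (a, b) k)" using True by simp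
    have IH: "l1 (proj_kernel (a, b))" "norm1 (proj_kernel (a, b)) \<le> 2" using 1 True by auto
    have "norm1 (proj_kernel (x # a, y # b)) \<le> norm1 (\<lambda>k. (1/2) * ?d k) + norm1 (\<lambda>k. (1/2) * proj_kernel (a, b) k)"
      unfolding e by (intro norm1_add l1_cmult d IH)
    also have "\<dots> \<le> 2" unfolding norm1_cmult using d2 IH by simp
    finally have "norm1 (proj_kernel (x # a, y # b)) \<le> 2" .
    moreover have "l1 (proj_kernel (x # a, y # b))" unfolding e by (intro l1_add l1_cmult d IH)
    ultimately show ?thesis by blast
  qed (simp add: l1_basis norm1_basis)
qed (auto simp: l1_basis norm1_basis)

interpretation proj_kernel: l1_kernel proj_kernel 2
  by standard (auto simp: proj_kernel_l1_norm1)

abbreviation L :: "(ix \<Rightarrow> complex) \<Rightarrow> ix \<Rightarrow> complex" where "L \<equiv> kernel_op proj_kernel"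

text \<open>Over the two children the basis differences cancel and the two halves of
  \<open>proj_kernel i\<close> add up. Hence every coordinate of \<open>L\<close> is one of the
  additive functionals.\<close>

lemma additive_proj_kernel: "additive (\<lambda>i. proj_kernel i k)"
  unfolding additive_def
proof (intro conjI allI)
  show "\<exists>C. \<forall>i. norm (proj_kernel i k) \<le> C" using proj_kernel.T_le by blast
  fix i show "proj_kernel i k = proj_kernel (child True i) k + proj_kernel (child False i) k"
    by (cases i) (simp add: field_simps)
qed

lemma L_annih: "annih F \<Longrightarrow> L F = (\<lambda>k. 0)"
proof
  fix k assume "annih F"
  then have "pair (\<lambda>i. proj_kernel i k) F = 0" using additive_proj_kernel by (simp add: annih_def)
  then show "L F k = 0" by (simp add: pair_def kernel_op_def mult.commute)
qed

section \<open>The kernel of the projection lies in the ideal\<close>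

lemma closed_ideal_rel:
  assumes I: "is_closed_ideal I" "f0 \<in> I"
  shows "of_coords (rel (a, b)) \<in> I"
proof -
  \<comment> \<open>\<open>A\<close> is s_alpha and \<open>B\<close> is s_beta^*, so A f0 B expands
    to the relation with index \<open>(a, b)\<close>.\<close>
  define A B where "A = of_coords (basis (a, []))" and "B = of_coords (basis ([], b))"
  have AB: "A \<in> ell1" "B \<in> ell1" by (auto simp: A_def B_def intro: of_coords_ell1 l1_basis)
  have in_I: "conv (conv A f0) B \<in> I" using I AB unfolding is_closed_ideal_def by blast
  have c: "pconv (basis i) (rel j) = (\<lambda>k. mult_kernel (i, j) k - mult_kernel (i, child True j) k - mult_kernel (i, child False j) k)" for i j
    unfolding rel_def by (simp add: pconv_diff_right l1_basis l1_diff pconv_basis)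
  have "pconv (basis (a, [])) (rel ([], [])) =
      (\<lambda>k. basis (a, []) k - basis (True # a, [True]) k - basis (False # a, [False]) k)"
    unfolding c by (simp add: mult_kernel_def)
  then have "coords (conv (conv A f0) B) = rel (a, b)"
    by (simp add: coords_conv coords_f0 A_def B_def coords_of_coords pconv_diff_left l1_basis l1_diff pconv_basis)
      (simp add: mult_kernel_def rel_def)
  moreover have "conv (conv A f0) B \<in> ell1" by (intro conv_ell1 AB f0_ell1)
  ultimately show ?thesis using in_I of_coords_coords by metis
qed

lemma closed_ideal_add: "is_closed_ideal I \<Longrightarrow> of_coords F \<in> I \<Longrightarrow> of_coords G \<in> I \<Longrightarrow> of_coords (\<lambda>i. F i + G i) \<in> I"
proof -
  have e: "(\<lambda>s. of_coords F s + of_coords G s) = of_coords (\<lambda>i. F i + G i)" by (auto simp: of_coords_def)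
  show "is_closed_ideal I \<Longrightarrow> of_coords F \<in> I \<Longrightarrow> of_coords G \<in> I \<Longrightarrow> of_coords (\<lambda>i. F i + G i) \<in> I"
    unfolding e[symmetric] is_closed_ideal_def by blast
qed

lemma closed_ideal_cmult: "is_closed_ideal I \<Longrightarrow> of_coords F \<in> I \<Longrightarrow> of_coords (\<lambda>i. c * F i) \<in> I"
proof -
  have e: "(\<lambda>s. c * of_coords F s) = of_coords (\<lambda>i. c * F i)" by (auto simp: of_coords_def)
  show "is_closed_ideal I \<Longrightarrow> of_coords F \<in> I \<Longrightarrow> of_coords (\<lambda>i. c * F i) \<in> I"
    unfolding e[symmetric] is_closed_ideal_def by blast
qed

text \<open>The two children add up to \<open>basis (a, b)\<close> minus \<open>rel (a, b)\<close>,
  so one step of the recursion turns the error into half the previous error minus half a relation.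
  Where the recursion stops the error is 0.\<close>

lemma closed_ideal_basis_diff:
  assumes I: "is_closed_ideal I" "f0 \<in> I"
  shows "of_coords (\<lambda>k. basis i k - proj_kernel i k) \<in> I"
proof (induction i rule: proj_kernel.induct)
  case (1 x a y b)
  have z: "of_coords (\<lambda>k. 0) \<in> I" using closed_ideal_cmult[OF I(1) closed_ideal_rel[OF I], of 0] by simp
  show ?case
  proof (cases "x = y")
    case True
    have e: "(\<lambda>k. basis (x # a, y # b) k - proj_kernel (x # a, y # b) k) =
        (\<lambda>k. (- 1/2) * rel (a, b) k + (1/2) * (basis (a, b) k - proj_kernel (a, b) k))"
      using True by (cases x) (auto simp: rel_def fun_eq_iff field_simps)
    show ?thesis unfolding e
      using 1[OF True] by (intro closed_ideal_add closed_ideal_cmult closed_ideal_rel I)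
  qed (use z in simp)
qed (use closed_ideal_cmult[OF I(1) closed_ideal_rel[OF I], of 0] in \<open>simp_all\<close>)

lemma closed_ideal_sum:
  assumes I: "is_closed_ideal I" "f0 \<in> I" and "finite A" "\<And>j. j \<in> A \<Longrightarrow> of_coords (F j) \<in> I"
  shows "of_coords (\<lambda>k. \<Sum>j\<in>A. F j k) \<in> I"
  using assms(3,4)
proof (induction A rule: finite_induct)
  case empty
  show ?case using closed_ideal_cmult[OF I(1) closed_ideal_rel[OF I], of 0] by simp
next
  case (insert j A)
  then have "of_coords (\<lambda>k. F j k + (\<Sum>j\<in>A. F j k)) \<in> I" by (intro closed_ideal_add I) auto
  then show ?case using insert by simp
qed

text \<open>Finite combinations of basis vectors are covered by
  \<open>closed_ideal_basis_diff\<close>; boundedness of \<open>L\<close> and closedness of the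
  ideal give the rest.\<close>

lemma closed_ideal_diff_L:
  assumes I: "is_closed_ideal I" "f0 \<in> I" and F: "l1 F"
  shows "of_coords (\<lambda>k. F k - L F k) \<in> I"
proof -
  have l: "l1 (\<lambda>k. F k - L F k)" by (intro l1_diff F proj_kernel.kernel_op_l1)
  have "\<exists>g\<in>I. l1norm (\<lambda>s. of_coords (\<lambda>k. F k - L F k) s - g s) < e" if e: "e > 0" for e
  proof -
    \<comment> \<open>Since \<open>L\<close> has norm at most 2, passing from \<open>F\<close> to
      \<open>S\<close> moves F - L F by at most three times \<open>norm1 D\<close>.\<close>
    have "e / 3 > 0" using e by simp
    from l1_finite_approx[OF F this] obtain A
      where A: "finite A" "norm1 (\<lambda>i. F i - (\<Sum>j\<in>A. F j * basis j i)) < e / 3" by blast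
    define S where "S = (\<lambda>i. \<Sum>j\<in>A. F j * basis j i)"
    have S: "l1 S" unfolding S_def by (intro l1_sum l1_cmult l1_basis)
    define D where "D = (\<lambda>i. F i - S i)"
    have D: "l1 D" unfolding D_def by (intro l1_diff F S)
    have LS: "L S = (\<lambda>k. \<Sum>j\<in>A. F j * proj_kernel j k)"
      unfolding S_def by (subst proj_kernel.kernel_op_sum) (auto simp: l1_cmult l1_basis proj_kernel.kernel_op_cmult proj_kernel.kernel_op_basis)
    have "of_coords (\<lambda>k. \<Sum>j\<in>A. F j * (basis j k - proj_kernel j k)) \<in> I"
      by (intro closed_ideal_sum closed_ideal_cmult closed_ideal_basis_diff I A)
    moreover have "(\<lambda>k. \<Sum>j\<in>A. F j * (basis j k - proj_kernel j k)) = (\<lambda>k. S k - L S k)"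
      unfolding LS by (simp add: S_def right_diff_distrib sum_subtractf)
    ultimately have g: "of_coords (\<lambda>k. S k - L S k) \<in> I" by simp
    have "(\<lambda>k. (F k - L F k) - (S k - L S k)) = (\<lambda>k. D k - L D k)"
      unfolding D_def by (simp add: proj_kernel.kernel_op_diff F S fun_eq_iff)
    then have "l1norm (\<lambda>s. of_coords (\<lambda>k. F k - L F k) s - of_coords (\<lambda>k. S k - L S k) s) = norm1 (\<lambda>k. D k - L D k)"
      by (simp add: l1norm_coords coords_diff coords_of_coords)
    also have "\<dots> \<le> norm1 D + 2 * norm1 D"
      using norm1_diff[OF D proj_kernel.kernel_op_l1[OF D]] proj_kernel.kernel_op_norm1[OF D] by simp
    also have "\<dots> < e" using A(2) by (simp add: D_def S_def)
    finally show ?thesis using g by blast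
  qed
  then show ?thesis using I(1) of_coords_ell1[OF l] unfolding is_closed_ideal_def by blast
qed

text \<open>\<open>L\<close> vanishes on the ideal because its coordinates are additive functionals.
  Conversely, if L f = 0 then f equals f - L f, which lies in every closed ideal containing
  \<open>f0\<close>.\<close>

lemma J_iff: "f \<in> J \<longleftrightarrow> f \<in> ell1 \<and> L (coords f) = (\<lambda>k. 0)"
proof
  assume "f \<in> J" then show "f \<in> ell1 \<and> L (coords f) = (\<lambda>k. 0)" using J_annih L_annih by blast
next
  assume f: "f \<in> ell1 \<and> L (coords f) = (\<lambda>k. 0)"
  then have "f \<in> I" if "is_closed_ideal I" "f0 \<in> I" for I
    using closed_ideal_diff_L[OF that ell1_l1[of f]] of_coords_coords[of f] by simp
  then show "f \<in> J" by (auto simp: J_def)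
qed

lemma L_idem: "l1 F \<Longrightarrow> L (L F) = L F"
proof -
  assume F: "l1 F"
  have "of_coords (\<lambda>k. F k - L F k) \<in> J" unfolding J_def using closed_ideal_diff_L[OF _ _ F] by blast
  then have "L (\<lambda>k. F k - L F k) = (\<lambda>k. 0)" by (simp add: J_iff coords_of_coords)
  then show ?thesis by (simp add: proj_kernel.kernel_op_diff F proj_kernel.kernel_op_l1 fun_eq_iff)
qed

lemma L_pconv_zero:
  assumes "l1 A" "l1 F" "L F = (\<lambda>k. 0)"
  shows "L (pconv A F) = (\<lambda>k. 0)" "L (pconv F A) = (\<lambda>k. 0)"
proof -
  have "of_coords F \<in> J" using assms by (simp add: J_iff coords_of_coords of_coords_ell1)
  then have "annih F" using J_annih coords_of_coords by metis
  then show "L (pconv A F) = (\<lambda>k. 0)" "L (pconv F A) = (\<lambda>k. 0)" using annih_pconv[OF assms(1)] L_annih by blast+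
qed

lemma L_pconv_cong:
  assumes l: "l1 F" "l1 F'" "l1 G" "l1 G'" and "L F = L F'" "L G = L G'"
  shows "L (pconv F G) = L (pconv F' G')"
proof -
  have "L (\<lambda>i. F i - F' i) = (\<lambda>k. 0)" "L (\<lambda>i. G i - G' i) = (\<lambda>k. 0)"
    using assms by (auto simp: proj_kernel.kernel_op_diff)
  \<comment> \<open>F G - F' G' = (F - F') G + F' (G - G').\<close>
  then have "L (pconv (\<lambda>i. F i - F' i) G) = (\<lambda>k. 0)" "L (pconv F' (\<lambda>i. G i - G' i)) = (\<lambda>k. 0)"
    using L_pconv_zero(2)[OF l(3) l1_diff[OF l(1,2)]] L_pconv_zero(1)[OF l(2) l1_diff[OF l(3,4)]] by simp_all
  then show ?thesis using l
    by (simp add: pconv_diff_left pconv_diff_right proj_kernel.kernel_op_diff l1_pconv fun_eq_iff)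
qed

text \<open>By idempotency \<open>L F\<close> and \<open>L G\<close> represent the same cosets as
  \<open>F\<close> and \<open>G\<close>, so the product can be computed from them; 2 is the norm
  bound of \<open>L\<close>.\<close>

lemma norm1_L_pconv:
  assumes "l1 F" "l1 G" shows "norm1 (L (pconv F G)) \<le> 2 * (norm1 (L F) * norm1 (L G))"
proof -
  note l = proj_kernel.kernel_op_l1[OF assms(1)] proj_kernel.kernel_op_l1[OF assms(2)]
  have e: "L (pconv F G) = L (pconv (L F) (L G))"
    by (rule L_pconv_cong) (simp_all add: assms l L_idem)
  have "norm1 (L (pconv (L F) (L G))) \<le> 2 * norm1 (pconv (L F) (L G))"
    by (rule proj_kernel.kernel_op_norm1[OF l1_pconv[OF l]])
  then show ?thesis unfolding e using norm1_pconv[OF l] by linarith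
qed

section \<open>Cosets and the operations of the quotient\<close>

lemma diff_in_J:
  assumes "f \<in> ell1" "g \<in> ell1"
  shows "(\<lambda>s. f s - g s) \<in> J \<longleftrightarrow> L (coords f) = L (coords g)"
proof -
  have "L (coords (\<lambda>s. f s - g s)) = (\<lambda>k. L (coords f) k - L (coords g) k)"
    unfolding coords_diff by (rule proj_kernel.kernel_op_diff[OF ell1_l1[OF assms(1)] ell1_l1[OF assms(2)]])
  then show ?thesis unfolding J_iff using ell1_diff[OF assms] by (auto simp: fun_eq_iff)
qed

lemma coset_eq: "f \<in> ell1 \<Longrightarrow> coset f = {g \<in> ell1. L (coords g) = L (coords f)}"
  unfolding coset_def using diff_in_J by blast

text \<open>Common pattern of the three operations: if \<open>b\<close> does not depend on the
  representatives modulo \<open>J\<close>, the set formed in \<open>AJ\<close> is a single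
  coset.\<close>

lemma coset_eqI:
  assumes "c \<in> ell1" "x \<in> X" "y \<in> Y"
    and "\<And>x y. x \<in> X \<Longrightarrow> y \<in> Y \<Longrightarrow> b x y \<in> ell1 \<and> L (coords (b x y)) = L (coords c)"
  shows "{h \<in> ell1. \<exists>x\<in>X. \<exists>y\<in>Y. (\<lambda>s. h s - b x y s) \<in> J} = coset c"
proof -
  have "(\<lambda>s. h s - b x y s) \<in> J \<longleftrightarrow> L (coords h) = L (coords c)"
    if "h \<in> ell1" "x \<in> X" "y \<in> Y" for h x y
    using diff_in_J[OF that(1), of "b x y"] assms(4)[OF that(2,3)] by simp
  then show ?thesis unfolding coset_eq[OF assms(1)] using assms(2,3) by blast
qed

lemma coset_self: "f \<in> ell1 \<Longrightarrow> f \<in> coset f"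
  by (simp add: coset_eq)

lemma coset_mem: "f \<in> ell1 \<Longrightarrow> g \<in> coset f \<Longrightarrow> g \<in> ell1 \<and> L (coords g) = L (coords f)"
  by (simp add: coset_eq)

lemma AJ_add:
  assumes "f \<in> ell1" "g \<in> ell1"
  shows "add AJ (coset f) (coset g) = coset (\<lambda>s. f s + g s)"
proof -
  have "{h \<in> ell1. \<exists>x\<in>coset f. \<exists>y\<in>coset g. (\<lambda>s. h s - (x s + y s)) \<in> J} = coset (\<lambda>s. f s + g s)"
  proof (rule coset_eqI[OF ell1_add[OF assms] coset_self[OF assms(1)] coset_self[OF assms(2)]])
    fix x y assume "x \<in> coset f" "y \<in> coset g"
    note xy = coset_mem[OF assms(1) this(1)] coset_mem[OF assms(2) this(2)]
    show "(\<lambda>s. x s + y s) \<in> ell1 \<and> L (coords (\<lambda>s. x s + y s)) = L (coords (\<lambda>s. f s + g s))"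
      using xy assms by (simp add: ell1_add coords_add proj_kernel.kernel_op_add ell1_l1)
  qed
  then show ?thesis by (simp add: AJ_def)
qed

lemma AJ_smul:
  assumes "f \<in> ell1"
  shows "smul AJ c (coset f) = coset (\<lambda>s. c * f s)"
proof -
  \<comment> \<open>A dummy second argument \<open>()\<close> makes the unary operation fit
    \<open>coset_eqI\<close>.\<close>
  have "{h \<in> ell1. \<exists>x\<in>coset f. \<exists>y\<in>{()}. (\<lambda>s. h s - c * x s) \<in> J} = coset (\<lambda>s. c * f s)"
  proof (rule coset_eqI[OF ell1_cmult[OF assms] coset_self[OF assms] singletonI])
    fix x assume "x \<in> coset f"
    note x = coset_mem[OF assms this]
    show "(\<lambda>s. c * x s) \<in> ell1 \<and> L (coords (\<lambda>s. c * x s)) = L (coords (\<lambda>s. c * f s))"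
      using x assms by (simp add: ell1_cmult coords_cmult proj_kernel.kernel_op_cmult)
  qed
  then show ?thesis by (simp add: AJ_def)
qed

lemma AJ_mul:
  assumes "f \<in> ell1" "g \<in> ell1"
  shows "mul AJ (coset f) (coset g) = coset (conv f g)"
proof -
  have "{h \<in> ell1. \<exists>x\<in>coset f. \<exists>y\<in>coset g. (\<lambda>s. h s - conv x y s) \<in> J} = coset (conv f g)"
  proof (rule coset_eqI[OF conv_ell1[OF assms] coset_self[OF assms(1)] coset_self[OF assms(2)]])
    fix x y assume "x \<in> coset f" "y \<in> coset g"
    note xy = coset_mem[OF assms(1) this(1)] coset_mem[OF assms(2) this(2)]
    have "L (pconv (coords x) (coords y)) = L (pconv (coords f) (coords g))"
      using xy assms by (intro L_pconv_cong) (simp_all add: ell1_l1)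
    then show "conv x y \<in> ell1 \<and> L (coords (conv x y)) = L (coords (conv f g))"
      using xy by (simp add: conv_ell1 coords_conv)
  qed
  then show ?thesis by (simp add: AJ_def)
qed

text \<open>The embedding of the quotient into l1. \<open>L\<close> is constant on each coset, so
  the choice of the representative is immaterial.\<close>

definition emb :: "(gen list set \<Rightarrow> complex) set \<Rightarrow> ix \<Rightarrow> complex" where
  "emb X = L (coords (SOME f. f \<in> X))"

lemma emb_coset:
  assumes "f \<in> ell1" shows "emb (coset f) = L (coords f)"
proof -
  have "(SOME g. g \<in> coset f) \<in> coset f"
    using coset_self[OF assms] by (rule someI[of "\<lambda>g. g \<in> coset f"])
  then show ?thesis unfolding emb_def using coset_mem[OF assms] by blast
qed

lemma AJ_carrier: "X \<in> carrier AJ \<longleftrightarrow> (\<exists>f\<in>ell1. X = coset f)"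
  by (auto simp: AJ_def)

section \<open>Khinchin's inequality\<close>

text \<open>The mean of \<open>G\<close> over \<open>x\<close> plus all signed sums of the list,
  that is, an expectation over independent fair signs.\<close>

fun avg :: "('v::ab_group_add \<Rightarrow> real) \<Rightarrow> 'v list \<Rightarrow> 'v \<Rightarrow> real" where
  "avg G [] x = G x"
| "avg G (a # as) x = (avg G as (x + a) + avg G as (x - a)) / 2"

lemma avg_mono: "(\<And>x. G x \<le> H x) \<Longrightarrow> avg G as x \<le> avg H as x"
  by (induction as arbitrary: x) (auto intro: add_mono)

lemma avg_linear: "avg (\<lambda>x. c * G x - d * H x) as x = c * avg G as x - d * avg H as x"
proof (induction as arbitrary: x)
  case (Cons a as)
  show ?case unfolding avg.simps Cons.IH by (simp add: field_simps)
qed simp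

lemma avg_sq: "avg (\<lambda>x::complex. (norm x)\<^sup>2) as x = (norm x)\<^sup>2 + (\<Sum>a\<leftarrow>as. (norm a)\<^sup>2)"
proof (induction as arbitrary: x)
  case (Cons a as)
  have "(norm (x + a))\<^sup>2 + (norm (x - a))\<^sup>2 = 2 * (norm x)\<^sup>2 + 2 * (norm a)\<^sup>2"
    by (simp add: power2_norm_eq_inner inner_commute algebra_simps)
  then show ?case by (simp add: Cons)
qed simp

text \<open>The starting point \<open>x\<close> is general for the induction; the application takes
  \<open>x = 0\<close>, where the bound is three times the squared second moment. Terms odd in the
  inner product of \<open>x\<close> and \<open>a\<close> cancel between the two signs.\<close>

lemma avg_fourth:
  "avg (\<lambda>x::complex. (norm x)^4) as x
     \<le> (norm x)^4 + 6 * (norm x)\<^sup>2 * (\<Sum>a\<leftarrow>as. (norm a)\<^sup>2) + 3 * (\<Sum>a\<leftarrow>as. (norm a)\<^sup>2)\<^sup>2"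
proof (induction as arbitrary: x)
  case (Cons a as)
  define S where "S = (\<Sum>a\<leftarrow>as. (norm a)\<^sup>2)"
  define X A t where "X = (norm x)\<^sup>2" and "A = (norm a)\<^sup>2" and "t = 2 * (x \<bullet> a)"
  have p: "(norm (x + a))\<^sup>2 = X + A + t" and m: "(norm (x - a))\<^sup>2 = X + A - t"
    unfolding X_def A_def t_def
    by (simp_all add: power2_norm_eq_inner inner_commute algebra_simps)
  have four: "u^4 = (u\<^sup>2)\<^sup>2" for u :: real by simp
  have t: "t\<^sup>2 \<le> 4 * (X * A)"
  proof -
    have "(x \<bullet> a)\<^sup>2 \<le> X * A" unfolding X_def A_def
      using Cauchy_Schwarz_ineq[of x a] by (simp add: power2_norm_eq_inner)
    then show ?thesis by (simp add: t_def power_mult_distrib)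
  qed
  have "avg (\<lambda>x::complex. (norm x)^4) (a # as) x
      \<le> (((X + A + t)\<^sup>2 + 6 * (X + A + t) * S + 3 * S\<^sup>2) + ((X + A - t)\<^sup>2 + 6 * (X + A - t) * S + 3 * S\<^sup>2)) / 2"
    using Cons[of "x + a"] Cons[of "x - a"] unfolding four p m S_def[symmetric] by simp
  also have "\<dots> = (X + A)\<^sup>2 + t\<^sup>2 + 6 * (X + A) * S + 3 * S\<^sup>2"
    by (simp add: power2_eq_square algebra_simps)
  also have "\<dots> \<le> (X + A)\<^sup>2 + 4 * (X * A) + 6 * (X + A) * S + 3 * S\<^sup>2" using t by simp
  also have "\<dots> \<le> X\<^sup>2 + 6 * X * (A + S) + 3 * (A + S)\<^sup>2"
    by (simp add: power2_eq_square algebra_simps)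
  finally show ?case unfolding four[of "norm x"] by (simp add: X_def A_def S_def)
qed simp

text \<open>Khinchin's inequality from the second and fourth moments, through the pointwise bound
  \<open>t \<ge> 3 b t\<^sup>2 - 4 b\<^sup>3 t\<^sup>4\<close>, which is \<open>(y + 1) (2 y - 1)\<^sup>2 \<ge> 0\<close> for \<open>y = b t\<close>.\<close>

lemma khinchin: "9 / 16 * sqrt (\<Sum>a\<leftarrow>as. (norm a)\<^sup>2) \<le> avg norm as (0::complex)"
proof -
  define S where "S = (\<Sum>a\<leftarrow>as. (norm a)\<^sup>2)"
  have S0: "0 \<le> S" unfolding S_def by (rule sum_list_nonneg) auto
  show ?thesis
  proof (cases "S = 0")
    case True
    have "0 \<le> avg norm as x" for x :: complex by (induction as arbitrary: x) auto
    then show ?thesis using True by (simp add: S_def)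
  next
    case False
    define s where "s = sqrt S"
    have s: "s > 0" "S = s\<^sup>2" using S0 False by (auto simp: s_def)
    \<comment> \<open>For \<open>b = c / s\<close> the moments give the lower bound
      \<open>(3 * c - 12 * c^3) * s\<close>; the rational \<open>c = 1/4\<close>, close to the
      maximiser, gives the constant 9/16.\<close>
    define b where "b = 1 / (4 * s)"
    have b: "b > 0" using s by (simp add: b_def)
    have pt: "3 * b * (norm x)\<^sup>2 - 4 * b^3 * (norm x)^4 \<le> norm x" for x :: complex
    proof -
      define t where "t = norm x"
      have "0 \<le> t * ((b * t + 1) * (2 * (b * t) - 1)\<^sup>2)"
        using b by (auto simp: t_def)
      also have "\<dots> = t - (3 * b * t\<^sup>2 - 4 * b^3 * t^4)"
        by (simp add: power2_eq_square power3_eq_cube power4_eq_xxxx algebra_simps)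
      finally show ?thesis by (simp add: t_def)
    qed
    have "9 / 16 * s = 3 * b * S - 4 * b^3 * (3 * S\<^sup>2)"
      using s by (simp add: b_def power2_eq_square power3_eq_cube field_simps)
    also have "\<dots> \<le> 3 * b * avg (\<lambda>x::complex. (norm x)\<^sup>2) as 0 - 4 * b^3 * avg (\<lambda>x::complex. (norm x)^4) as 0"
      using avg_fourth[of as 0] b by (intro diff_mono mult_left_mono) (auto simp: avg_sq S_def)
    also have "\<dots> = avg (\<lambda>x::complex. 3 * b * (norm x)\<^sup>2 - 4 * b^3 * (norm x)^4) as 0"
      by (rule avg_linear[symmetric])
    also have "\<dots> \<le> avg norm as 0" by (rule avg_mono[OF pt])
    finally show ?thesis by (simp add: s_def S_def)
  qed
qed

section \<open>Sign averages of l1 vectors\<close>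

fun vavg :: "('x \<Rightarrow> complex) list \<Rightarrow> ('x \<Rightarrow> complex) \<Rightarrow> real" where
  "vavg [] x = norm1 x"
| "vavg (a # as) x = (vavg as (\<lambda>i. x i + a i) + vavg as (\<lambda>i. x i - a i)) / 2"

text \<open>\<open>vavg\<close> is the mean of the l1 norm over all signs; interchanging it with the
  sum over the coordinates reduces it to the scalar means.\<close>

lemma vavg_pointwise:
  assumes "\<forall>v\<in>set vs. l1 v" "l1 x"
  shows "((\<lambda>i. avg norm (map (\<lambda>v. v i) vs) (x i)) has_sum vavg vs x) UNIV"
  using assms
proof (induction vs arbitrary: x)
  case Nil then show ?case by (simp add: norm1_def l1_def)
next
  case (Cons a vs)
  have "((\<lambda>i. (avg norm (map (\<lambda>v. v i) vs) (x i + a i) + avg norm (map (\<lambda>v. v i) vs) (x i - a i)) * (1/2))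
     has_sum (vavg vs (\<lambda>i. x i + a i) + vavg vs (\<lambda>i. x i - a i)) * (1/2)) UNIV"
    using Cons by (intro has_sum_cmult_left has_sum_add Cons.IH) (auto intro: l1_add l1_diff)
  then show ?case by simp
qed

lemma vavg_le:
  assumes "\<And>\<epsilon>. (\<forall>i. \<epsilon> i = 1 \<or> \<epsilon> i = -1) \<Longrightarrow> norm1 (\<lambda>k. x k + (\<Sum>i<length vs. \<epsilon> i * (vs ! i) k)) \<le> M"
  shows "vavg vs x \<le> M"
  using assms
proof (induction vs arbitrary: x)
  case Nil from Nil[of "\<lambda>_. 1"] show ?case by simp
next
  case (Cons a vs)
  have *: "vavg vs (\<lambda>i. x i + c * a i) \<le> M" if c: "c = 1 \<or> c = -1" for c
  proof (rule Cons.IH)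
    fix \<epsilon> :: "nat \<Rightarrow> complex" assume "\<forall>i. \<epsilon> i = 1 \<or> \<epsilon> i = -1"
    then have "norm1 (\<lambda>k. x k + (\<Sum>i<length (a # vs). case_nat c \<epsilon> i * ((a # vs) ! i) k)) \<le> M"
      using c by (intro Cons.prems) (auto split: nat.split)
    then show "norm1 (\<lambda>k. x k + c * a k + (\<Sum>i<length vs. \<epsilon> i * (vs ! i) k)) \<le> M"
      by (simp add: sum.lessThan_Suc_shift add.assoc del: sum.lessThan_Suc)
  qed
  from *[of 1] *[of "-1"] show ?case by simp
qed

lemma has_sum_finite_sum:
  fixes f :: "nat \<Rightarrow> 'x \<Rightarrow> real"
  assumes "\<And>i. (f i has_sum s i) A"
  shows "((\<lambda>k. \<Sum>i<N. f i k) has_sum (\<Sum>i<N. s i)) A"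
  by (induction N) (auto intro: has_sum_add assms)

lemma sum_le_sqrt: "(\<Sum>i<N::nat. (f i :: real)) \<le> sqrt N * sqrt (\<Sum>i<N. (f i)\<^sup>2)"
proof -
  have "(\<Sum>i<N. 1 * f i)\<^sup>2 \<le> (\<Sum>i<N. 1\<^sup>2) * (\<Sum>i<N. (f i)\<^sup>2)" by (rule Cauchy_Schwarz_ineq_sum)
  then show ?thesis by (simp add: real_le_rsqrt flip: real_sqrt_mult)
qed

text \<open>\<open>\<ell>\<^sup>1\<close> has cotype 2.\<close>

lemma l1_signs_unbounded:
  fixes v :: "nat \<Rightarrow> 'x \<Rightarrow> complex"
  assumes l: "\<And>i. l1 (v i)" and c: "\<And>i. c \<le> norm1 (v i)" and "c > 0"
  shows "\<exists>N \<epsilon>. (\<forall>i. \<epsilon> i = 1 \<or> \<epsilon> i = -1) \<and> norm1 (\<lambda>k. \<Sum>i<N. \<epsilon> i * v i k) > M"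
proof (rule ccontr)
  assume "\<not> ?thesis"
  then have M: "norm1 (\<lambda>k. \<Sum>i<N. \<epsilon> i * v i k) \<le> M" if "\<forall>i. \<epsilon> i = 1 \<or> \<epsilon> i = -1" for N \<epsilon>
    using that by (meson not_le)
  \<comment> \<open>Khinchin in each coordinate bounds the mean norm of the signed sums from below
    by square functions, and Cauchy-Schwarz compares these with the sum of the norms; the gain is
    \<open>sqrt N\<close>.\<close>
  have b: "9 / 16 * (sqrt N * c) \<le> M" for N :: nat
  proof (cases "N = 0")
    case True
    then show ?thesis using M[of "\<lambda>_. 1" 0] by (simp add: norm1_0)
  next
    case False
    define vs where "vs = map v [0..<N]"
    have nth: "vs ! i = v i" if "i < N" for i using that by (simp add: vs_def)
    have len: "length vs = N" by (simp add: vs_def)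
    have vl: "vavg vs (\<lambda>_. 0) \<le> M"
      by (rule vavg_le) (use M len nth in \<open>simp\<close>)
    have h: "((\<lambda>i. avg norm (map (\<lambda>v. v i) vs) 0) has_sum vavg vs (\<lambda>_. 0)) UNIV"
      by (rule vavg_pointwise) (auto simp: l1_0 vs_def l)
    have g: "((\<lambda>k. 9 / 16 / sqrt N * (\<Sum>i<N. norm (v i k))) has_sum 9 / 16 / sqrt N * (\<Sum>i<N. norm1 (v i))) UNIV"
      using l unfolding l1_def norm1_def by (intro has_sum_cmult_right has_sum_finite_sum) auto
    have pt: "9 / 16 / sqrt N * (\<Sum>i<N. norm (v i k)) \<le> avg norm (map (\<lambda>v. v k) vs) 0" for k
    proof -
      have sl: "(\<Sum>a\<leftarrow>map (\<lambda>v. v k) vs. (norm a)\<^sup>2) = (\<Sum>i<N. (norm (v i k))\<^sup>2)"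
        by (simp add: vs_def o_def interv_sum_list_conv_sum_set_nat atLeast0LessThan)
      have "1 / sqrt N * (\<Sum>i<N. norm (v i k)) \<le> sqrt (\<Sum>i<N. (norm (v i k))\<^sup>2)"
        using sum_le_sqrt[of "\<lambda>i. norm (v i k)" N] False by (simp add: field_simps)
      then show ?thesis using khinchin[of "map (\<lambda>v. v k) vs"] unfolding sl by simp
    qed
    have "9 / 16 * (sqrt N * c) = 9 / 16 / sqrt N * (\<Sum>i<N. c)"
      using False by (simp add: field_simps)
    also have "\<dots> \<le> 9 / 16 / sqrt N * (\<Sum>i<N. norm1 (v i))"
      by (intro mult_left_mono sum_mono c) auto
    also have "\<dots> \<le> vavg vs (\<lambda>_. 0)" by (rule has_sum_mono[OF g h pt])
    also have "\<dots> \<le> M" by (rule vl)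
    finally show ?thesis .
  qed
  \<comment> \<open>The choice \<open>N = n\<^sup>2\<close> makes \<open>sqrt N\<close> equal to
    \<open>n\<close>, which is unbounded.\<close>
  obtain n :: nat where n: "n > M / (9 / 16 * c)" using reals_Archimedean2 by blast
  have "9 / 16 * (sqrt (n\<^sup>2) * c) \<le> M" using b[of "n\<^sup>2"] by simp
  then show False using n \<open>c > 0\<close> by (simp add: field_simps)
qed

section \<open>Diagonal operators\<close>

definition diag_op :: "real \<Rightarrow> (nat \<Rightarrow> complex) \<Rightarrow> op" where
  "diag_op p h = op_restr p (\<lambda>x n. h n * x n)"

definition bounded_seq :: "(nat \<Rightarrow> complex) \<Rightarrow> bool" where
  "bounded_seq h \<longleftrightarrow> (\<exists>C. \<forall>n. norm (h n) \<le> C)"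

lemma bounded_seq_const: "bounded_seq (\<lambda>n. c)"
  by (auto simp: bounded_seq_def)

lemma bounded_seq_add: "bounded_seq h \<Longrightarrow> bounded_seq g \<Longrightarrow> bounded_seq (\<lambda>n. h n + g n)"
  unfolding bounded_seq_def by (meson add_mono norm_triangle_ineq order_trans)

lemma bounded_seq_mult: "bounded_seq h \<Longrightarrow> bounded_seq g \<Longrightarrow> bounded_seq (\<lambda>n. h n * g n)"
  unfolding bounded_seq_def norm_mult by (meson mult_mono' norm_ge_zero)

lemma lp_mult:
  assumes "p > 0" "x \<in> lp p" "\<And>n. norm (h n) \<le> C"
  shows "(\<lambda>n. h n * x n) \<in> lp p" "lpnorm p (\<lambda>n. h n * x n) \<le> C * lpnorm p x"
proof -
  have C: "0 \<le> C" using assms(3) norm_ge_zero order_trans by blast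
  have s: "summable (\<lambda>n. norm (x n) powr p)" using assms(2) by (simp add: lp_def)
  have le: "norm (h n * x n) powr p \<le> C powr p * norm (x n) powr p" for n
  proof -
    have "norm (h n * x n) powr p \<le> (C * norm (x n)) powr p"
      using assms(1,3) by (intro powr_mono2) (auto simp: norm_mult mult_right_mono)
    then show ?thesis using C by (simp add: powr_mult)
  qed
  have s2: "summable (\<lambda>n. C powr p * norm (x n) powr p)" using s by (rule summable_mult)
  have s1: "summable (\<lambda>n. norm (h n * x n) powr p)"
    by (rule summable_comparison_test'[OF s2]) (use le in auto)
  then show "(\<lambda>n. h n * x n) \<in> lp p" using assms(2) by (simp add: lp_def)
  have "(\<Sum>n. norm (h n * x n) powr p) \<le> (\<Sum>n. C powr p * norm (x n) powr p)"
    by (rule suminf_le[OF le s1 s2])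
  also have "\<dots> = C powr p * (\<Sum>n. norm (x n) powr p)" using s by (rule suminf_mult)
  finally have "lpnorm p (\<lambda>n. h n * x n) \<le> (C powr p * (\<Sum>n. norm (x n) powr p)) powr (1 / p)"
    unfolding lpnorm_def using assms(1) s1 by (intro powr_mono2) (auto intro: suminf_nonneg)
  also have "\<dots> = C * lpnorm p x"
    using C assms(1) s by (simp add: lpnorm_def powr_mult powr_powr suminf_nonneg)
  finally show "lpnorm p (\<lambda>n. h n * x n) \<le> C * lpnorm p x" .
qed

lemma lp_bounded_seq: "p > 0 \<Longrightarrow> x \<in> lp p \<Longrightarrow> bounded_seq h \<Longrightarrow> (\<lambda>n. h n * x n) \<in> lp p"
  using lp_mult(1) unfolding bounded_seq_def by blast

lemma lp_0: "(\<lambda>n. 0) \<in> lp p"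
  by (simp add: lp_def)

lemma lp_add:
  assumes "p > 0" "x \<in> lp p" "y \<in> lp p" shows "(\<lambda>n. x n + y n) \<in> lp p"
proof -
  have s: "summable (\<lambda>n. 2 powr p * (norm (x n) powr p + norm (y n) powr p))"
    using assms by (intro summable_mult summable_add) (auto simp: lp_def)
  have le: "norm (x n + y n) powr p \<le> 2 powr p * (norm (x n) powr p + norm (y n) powr p)" for n
  proof -
    define m where "m = max (norm (x n)) (norm (y n))"
    have "norm (x n + y n) \<le> 2 * m" using norm_triangle_ineq[of "x n" "y n"] by (simp add: m_def)
    then have "norm (x n + y n) powr p \<le> (2 * m) powr p" using assms(1) by (intro powr_mono2) auto
    also have "\<dots> = 2 powr p * m powr p" by (simp add: powr_mult m_def)
    also have "m powr p \<le> norm (x n) powr p + norm (y n) powr p" by (simp add: m_def max_def)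
    finally show ?thesis by simp
  qed
  have "summable (\<lambda>n. norm (x n + y n) powr p)"
    by (rule summable_comparison_test'[OF s]) (use le in auto)
  then show ?thesis using assms by (simp add: lp_def)
qed

lemma lp_reindex:
  assumes "x \<in> lp p" "inj f" "f 0 = 0" shows "(\<lambda>n. x (f n)) \<in> lp p"
proof -
  have "(\<lambda>n. norm (x n) powr p) summable_on UNIV"
    using assms(1) by (simp add: lp_def summable_on_UNIV_nonneg_real_iff)
  then have "(\<lambda>n. norm (x n) powr p) summable_on range f" by (rule summable_on_subset_banach) auto
  then have "(\<lambda>n. norm (x (f n)) powr p) summable_on UNIV"
    using assms(2) by (simp add: summable_on_reindex o_def)
  then show ?thesis using assms by (simp add: lp_def summable_on_UNIV_nonneg_real_iff)
qed

lemma opA1_eq: "x \<in> lp p \<Longrightarrow> opA1 p x = (\<lambda>n. x (2 * n))"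
  by (auto simp: opA1_def op_restr_def lp_def)

text \<open>At \<open>n = 0\<close> truncated subtraction gives the index 0, where sequences vanish,
  so the case distinction disappears.\<close>

lemma opA2_eq: "x \<in> lp p \<Longrightarrow> opA2 p x = (\<lambda>n. x (2 * n - 1))"
  by (auto simp: opA2_def op_restr_def lp_def)

lemma opA1_lp: "x \<in> lp p \<Longrightarrow> opA1 p x \<in> lp p"
  unfolding opA1_eq by (rule lp_reindex) (auto simp: inj_def)

lemma opA2_lp: "x \<in> lp p \<Longrightarrow> opA2 p x \<in> lp p"
proof -
  have "inj (\<lambda>n::nat. 2 * n - 1)" by (rule injI) presburger
  then show "x \<in> lp p \<Longrightarrow> opA2 p x \<in> lp p"
    using lp_reindex[of x p "\<lambda>n. 2 * n - 1"] by (simp add: opA2_eq)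
qed

text \<open>\<open>sh0 h\<close> and \<open>sh1 h\<close> are the diagonals of B1 D A1 and B2 D A2,
  where D has the diagonal \<open>h\<close>.\<close>

definition sh0 :: "(nat \<Rightarrow> complex) \<Rightarrow> nat \<Rightarrow> complex" where
  "sh0 h = (\<lambda>n. if n \<noteq> 0 \<and> even n then h (n div 2) else 0)"

definition sh1 :: "(nat \<Rightarrow> complex) \<Rightarrow> nat \<Rightarrow> complex" where
  "sh1 h = (\<lambda>n. if odd n then h ((n + 1) div 2) else 0)"

lemma bounded_seq_sh0: "bounded_seq h \<Longrightarrow> bounded_seq (sh0 h)" and bounded_seq_sh1: "bounded_seq h \<Longrightarrow> bounded_seq (sh1 h)"
proof -
  assume "bounded_seq h"
  then obtain C where C: "\<And>n. norm (h n) \<le> C" by (auto simp: bounded_seq_def)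
  then have "0 \<le> C" using norm_ge_zero order_trans by blast
  then show "bounded_seq (sh0 h)" "bounded_seq (sh1 h)" using C by (auto simp: bounded_seq_def sh0_def sh1_def intro!: exI[of _ C])
qed

lemma op_mul_diag_op: "p > 0 \<Longrightarrow> bounded_seq g \<Longrightarrow> op_mul (diag_op p h) (diag_op p g) = diag_op p (\<lambda>n. h n * g n)"
  by (auto simp: op_mul_def diag_op_def op_restr_def lp_bounded_seq lp_0 mult.assoc)

lemma op_add_diag_op: "op_add (diag_op p h) (diag_op p g) = diag_op p (\<lambda>n. h n + g n)"
  by (auto simp: op_add_def diag_op_def op_restr_def fun_eq_iff distrib_right)

lemma op_smul_diag_op: "op_smul c (diag_op p h) = diag_op p (\<lambda>n. c * h n)"
  by (auto simp: op_smul_def diag_op_def op_restr_def fun_eq_iff mult.assoc)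

lemma diag_op_sh0:
  assumes "p > 0" "bounded_seq h"
  shows "op_mul (opB1 p) (op_mul (diag_op p h) (opA1 p)) = diag_op p (sh0 h)"
proof
  fix x
  show "op_mul (opB1 p) (op_mul (diag_op p h) (opA1 p)) x = diag_op p (sh0 h) x"
  proof (cases "x \<in> lp p")
    case True
    then have "diag_op p h (opA1 p x) = (\<lambda>n. h n * x (2 * n))"
      using opA1_lp[OF True] by (simp add: diag_op_def op_restr_def opA1_eq)
    moreover have "(\<lambda>n. h n * x (2 * n)) \<in> lp p"
      using lp_bounded_seq[OF assms(1) opA1_lp[OF True] assms(2)] by (simp add: opA1_eq True)
    ultimately show ?thesis using True
      by (simp add: op_mul_def opB1_def op_restr_def) (auto simp: diag_op_def op_restr_def sh0_def fun_eq_iff)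
  next
    case False
    then show ?thesis by (auto simp: op_mul_def opA1_def opB1_def op_restr_def diag_op_def lp_0 fun_eq_iff)
  qed
qed

lemma diag_op_sh1:
  assumes "p > 0" "bounded_seq h"
  shows "op_mul (opB2 p) (op_mul (diag_op p h) (opA2 p)) = diag_op p (sh1 h)"
proof
  fix x
  show "op_mul (opB2 p) (op_mul (diag_op p h) (opA2 p)) x = diag_op p (sh1 h) x"
  proof (cases "x \<in> lp p")
    case True
    then have "diag_op p h (opA2 p x) = (\<lambda>n. h n * x (2 * n - 1))"
      using opA2_lp[OF True] by (simp add: diag_op_def op_restr_def opA2_eq)
    moreover have "(\<lambda>n. h n * x (2 * n - 1)) \<in> lp p"
      using lp_bounded_seq[OF assms(1) opA2_lp[OF True] assms(2)] by (simp add: opA2_eq True)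
    moreover have "2 * (Suc n div 2) - Suc 0 = n" if "odd n" for n :: nat using that by presburger
    ultimately show ?thesis using True
      by (simp add: op_mul_def opB2_def op_restr_def) (auto simp: diag_op_def op_restr_def sh1_def fun_eq_iff)
  next
    case False
    then show ?thesis by (auto simp: op_mul_def opA2_def opB2_def op_restr_def diag_op_def lp_0 fun_eq_iff)
  qed
qed

section \<open>Diagonals in the generated algebra and in its closure\<close>

definition gdiag :: "real \<Rightarrow> (nat \<Rightarrow> complex) set" where
  "gdiag p = {h. bounded_seq h \<and> diag_op p h \<in> gen_alg p}"

lemma gdiag_1: "(\<lambda>n. 1) \<in> gdiag p"
  using ga_I[of p] by (simp add: gdiag_def bounded_seq_const diag_op_def opI_def)

lemma gdiag_add: "h \<in> gdiag p \<Longrightarrow> g \<in> gdiag p \<Longrightarrow> (\<lambda>n. h n + g n) \<in> gdiag p"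
  using ga_add[of "diag_op p h" p "diag_op p g"] by (simp add: gdiag_def bounded_seq_add op_add_diag_op)

lemma gdiag_smul: "h \<in> gdiag p \<Longrightarrow> (\<lambda>n. c * h n) \<in> gdiag p"
  using ga_smul[of "diag_op p h" p c] by (simp add: gdiag_def bounded_seq_mult bounded_seq_const op_smul_diag_op)

lemma gdiag_sh0: "p > 0 \<Longrightarrow> h \<in> gdiag p \<Longrightarrow> sh0 h \<in> gdiag p"
  using ga_mul[OF ga_B1 ga_mul[OF _ ga_A1], of "diag_op p h" p] by (simp add: gdiag_def bounded_seq_sh0 diag_op_sh0)

lemma gdiag_sh1: "p > 0 \<Longrightarrow> h \<in> gdiag p \<Longrightarrow> sh1 h \<in> gdiag p"
  using ga_mul[OF ga_B2 ga_mul[OF _ ga_A2], of "diag_op p h" p] by (simp add: gdiag_def bounded_seq_sh1 diag_op_sh1)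

lemma gdiag_sum:
  "(\<And>i. i < (N::nat) \<Longrightarrow> F i \<in> gdiag p) \<Longrightarrow> (\<lambda>n. \<Sum>i<N. F i n) \<in> gdiag p"
proof (induction N)
  case 0 show ?case using gdiag_smul[OF gdiag_1, of 0] by simp
qed (auto intro: gdiag_add)

lemma opnorm_diag_op_le:
  assumes "p > 0" "\<And>n. norm (h n) \<le> C"
  shows "opnorm p (diag_op p h) \<le> C"
  unfolding opnorm_def
proof (rule cSup_least)
  have "lpnorm p (\<lambda>n. 0) \<le> 1" by (simp add: lpnorm_def)
  then show "{lpnorm p (diag_op p h x) |x. x \<in> lp p \<and> lpnorm p x \<le> 1} \<noteq> {}" using lp_0 by blast
next
  have C: "0 \<le> C" using assms(2) norm_ge_zero order_trans by blast
  fix r assume "r \<in> {lpnorm p (diag_op p h x) |x. x \<in> lp p \<and> lpnorm p x \<le> 1}"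
  then obtain x where x: "x \<in> lp p" "lpnorm p x \<le> 1" "r = lpnorm p (diag_op p h x)" by blast
  then have "r \<le> C * lpnorm p x"
    using lp_mult(2)[OF assms(1) x(1) assms(2)] by (simp add: diag_op_def op_restr_def)
  also have "\<dots> \<le> C * 1" by (rule mult_left_mono[OF x(2) C])
  finally show "r \<le> C" by simp
qed

lemma bdd_op_diag_op:
  assumes "p > 0" "bounded_seq h" shows "bdd_op p (diag_op p h)"
proof -
  obtain C where C: "\<And>n. norm (h n) \<le> C" using assms(2) by (auto simp: bounded_seq_def)
  have "\<exists>C. \<forall>x\<in>lp p. lpnorm p (diag_op p h x) \<le> C * lpnorm p x"
    using lp_mult(2)[OF assms(1), of _ h C] C by (auto simp: diag_op_def op_restr_def intro!: exI[of _ C])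
  then show ?thesis unfolding bdd_op_def
    using lp_bounded_seq[OF assms(1) _ bounded_seq_const] assms
    by (auto simp: diag_op_def op_restr_def lp_bounded_seq lp_add fun_eq_iff distrib_left)
qed

definition diag :: "real \<Rightarrow> (nat \<Rightarrow> complex) set" where
  "diag p = {h. bounded_seq h \<and> diag_op p h \<in> O2p_set p}"

text \<open>The operator norm of a diagonal operator is at most the supremum of its entries, so
  uniform approximation of the diagonal is approximation in norm.\<close>

lemma diagI:
  assumes "p > 0" "\<And>e. e > 0 \<Longrightarrow> \<exists>g\<in>gdiag p. \<forall>n. norm (h n - g n) \<le> e"
  shows "h \<in> diag p"
proof -
  obtain g where g: "g \<in> gdiag p" "\<forall>n. norm (h n - g n) \<le> 1" using assms(2)[of 1] by auto
  have "bounded_seq (\<lambda>n. (h n - g n) + g n)"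
    by (rule bounded_seq_add) (use g in \<open>auto simp: gdiag_def bounded_seq_def[of "\<lambda>n. h n - g n"]\<close>)
  then have b: "bounded_seq h" by simp
  have "\<exists>S\<in>gen_alg p. opnorm p (op_add (diag_op p h) (op_smul (-1) S)) < e" if "e > 0" for e
  proof -
    obtain g where g: "g \<in> gdiag p" "\<forall>n. norm (h n - g n) \<le> e/2"
      using assms(2)[of "e/2"] \<open>e > 0\<close> half_gt_zero by blast
    have "opnorm p (diag_op p (\<lambda>n. h n - g n)) \<le> e/2" by (rule opnorm_diag_op_le) (use g assms in auto)
    then have "opnorm p (op_add (diag_op p h) (op_smul (-1) (diag_op p g))) < e"
      using that by (simp add: op_add_diag_op op_smul_diag_op)
    then show ?thesis using g(1) by (auto simp: gdiag_def)
  qed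
  then show ?thesis using b bdd_op_diag_op[OF assms(1) b] by (simp add: diag_def O2p_set_def)
qed

lemma gdiag_diag: "p > 0 \<Longrightarrow> h \<in> gdiag p \<Longrightarrow> h \<in> diag p"
  by (rule diagI) (auto intro!: bexI[of _ h])

lemma diag_op_inj:
  assumes "diag_op p h = diag_op p g" "m > 0" shows "h m = g m"
proof -
  define x where "x = (\<lambda>n. if n = m then 1 else (0::complex))"
  have "summable (\<lambda>n. norm (x n) powr p)"
    by (rule summable_finite[of "{m}"]) (auto simp: x_def)
  then have "x \<in> lp p" using assms(2) by (simp add: lp_def x_def)
  then have "(\<lambda>n. h n * x n) = (\<lambda>n. g n * x n)"
    using fun_cong[OF assms(1), of x] by (simp add: diag_op_def op_restr_def)
  from fun_cong[OF this, of m] show ?thesis by (simp add: x_def)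
qed

text \<open>\<open>h\<close> is moved to the positive integers divisible by 2 exactly
  \<open>n\<close> times: \<open>block n h (2^n * (2 * m - 1)) = h m\<close> for
  \<open>m > 0\<close>, and all other values are 0. On operators this is B1^n B2 D A2 A1^n, where D
  has the diagonal \<open>h\<close>.\<close>

fun block :: "nat \<Rightarrow> (nat \<Rightarrow> complex) \<Rightarrow> nat \<Rightarrow> complex" where
  "block 0 h = sh1 h"
| "block (Suc n) h = sh0 (block n h)"

lemma gdiag_block: "p > 0 \<Longrightarrow> h \<in> gdiag p \<Longrightarrow> block n h \<in> gdiag p"
  by (induction n) (auto intro: gdiag_sh0 gdiag_sh1)

lemma block_mult:
  "block n h k * block m g k = (if n = m then block n (\<lambda>k. h k * g k) k else 0)"
proof (induction n arbitrary: m k)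
  case 0 then show ?case by (cases m) (auto simp: sh0_def sh1_def)
next
  case (Suc n)
  show ?case
  proof (cases m)
    case (Suc m')
    then show ?thesis using Suc.IH[of "k div 2" m'] by (auto simp: sh0_def)
  qed (auto simp: sh0_def sh1_def)
qed

text \<open>The support of block \<open>n\<close> begins at \<open>2^n > n\<close>. Hence a series
  over the blocks is a finite sum at each position.\<close>

lemma block_small: "k \<le> n \<Longrightarrow> block n h k = 0"
  by (induction n arbitrary: k) (auto simp: sh0_def sh1_def)

lemma block_norm_le: "(\<And>k. norm (h k) \<le> C) \<Longrightarrow> 0 \<le> C \<Longrightarrow> norm (block n h k) \<le> C"
  by (induction n arbitrary: k) (auto simp: sh0_def sh1_def)

lemma block_nonzero: "m > 0 \<Longrightarrow> h m \<noteq> 0 \<Longrightarrow> \<exists>k>0. block n h k \<noteq> 0"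
proof (induction n)
  case 0 then show ?case by (intro exI[of _ "2 * m - 1"]) (auto simp: sh1_def)
next
  case (Suc n)
  then obtain k where "k > 0" "block n h k \<noteq> 0" by auto
  then show ?case by (intro exI[of _ "2 * k"]) (auto simp: sh0_def)
qed

lemma block_linear: "block n (\<lambda>k. h k + g k) k = block n h k + block n g k"
    "block n (\<lambda>k. c * h k) k = c * block n h k"
  by (induction n arbitrary: k) (auto simp: sh0_def sh1_def)

lemma block_sum: "block n (\<lambda>k. \<Sum>i<(N::nat). f i k) k = (\<Sum>i<N. block n (f i) k)"
  by (induction n arbitrary: k) (auto simp: sh0_def sh1_def)

lemma sum_block_signs_le:
  assumes "\<forall>i. \<epsilon> i = 1 \<or> \<epsilon> i = (-1::complex)"
  shows "norm (\<Sum>i<(N::nat). \<epsilon> i * block i (\<lambda>_. 1) k) \<le> 1"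
proof (cases "\<exists>j<N. block j (\<lambda>_. 1) k \<noteq> 0")
  case False
  then have "(\<Sum>i<N. \<epsilon> i * block i (\<lambda>_. 1) k) = 0" by (intro sum.neutral) auto
  then show ?thesis by simp
next
  case True
  then obtain j where j: "j < N" "block j (\<lambda>_. 1) k \<noteq> 0" by blast
  have "block i (\<lambda>_. 1) k = 0" if "i \<noteq> j" for i
    using block_mult[of i "\<lambda>_. 1" k j "\<lambda>_. 1"] that j by simp
  then have "(\<Sum>i<N. \<epsilon> i * block i (\<lambda>_. 1) k) = (\<Sum>i\<in>{j}. \<epsilon> i * block i (\<lambda>_. 1) k)"
    using j(1) by (intro sum.mono_neutral_right) auto
  moreover have "norm (block j (\<lambda>_. 1) k) \<le> 1" by (rule block_norm_le) auto
  moreover have "norm (\<epsilon> j) = 1" using assms by (metis norm_one norm_minus_cancel)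
  ultimately show ?thesis by (simp add: norm_mult)
qed

section \<open>The contradiction with an embedding into l1\<close>

lemma geometric_tail: "(\<Sum>n\<in>{k..<m}. (1/2)^n) \<le> 2 * (1/2::real)^k"
proof (cases "k \<le> m")
  case True
  then have "(\<Sum>n\<in>{k..<m}. (1/2)^n) = 2 * (1/2::real)^k - 2 * (1/2)^m"
    by (induction rule: dec_induct) (auto simp: sum.atLeastLessThan_Suc)
  then show ?thesis by simp
qed simp

text \<open>\<open>\<Gamma>\<close> stands for a homomorphism into the quotient followed by
  \<open>emb\<close>, and \<open>K\<close> for the constant of \<open>norm1_L_pconv\<close>. The
  equation \<open>S = op_smul 0 S\<close> says that \<open>S\<close> is the zero operator.\<close>

lemma no_l1_embedding:
  fixes \<Gamma> :: "op \<Rightarrow> 'x \<Rightarrow> complex"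
  assumes p: "p > 0"
    and l: "\<And>S. S \<in> O2p_set p \<Longrightarrow> l1 (\<Gamma> S)"
    and add: "\<And>S T. S \<in> O2p_set p \<Longrightarrow> T \<in> O2p_set p \<Longrightarrow> \<Gamma> (op_add S T) = (\<lambda>i. \<Gamma> S i + \<Gamma> T i)"
    and smul: "\<And>c S. S \<in> O2p_set p \<Longrightarrow> \<Gamma> (op_smul c S) = (\<lambda>i. c * \<Gamma> S i)"
    and mul: "\<And>S T. S \<in> O2p_set p \<Longrightarrow> T \<in> O2p_set p \<Longrightarrow>
        norm1 (\<Gamma> (op_mul S T)) \<le> K * (norm1 (\<Gamma> S) * norm1 (\<Gamma> T))"
    and inj: "\<And>S. S \<in> O2p_set p \<Longrightarrow> \<Gamma> S = (\<lambda>i. 0) \<Longrightarrow> S = op_smul 0 S"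
  shows False
proof -
  define G where "G = (\<lambda>h. \<Gamma> (diag_op p h))"
  have Gl: "l1 (G h)" if "h \<in> diag p" for h using that l by (simp add: G_def diag_def)
  have Gadd: "G (\<lambda>n. h n + g n) = (\<lambda>i. G h i + G g i)" if "h \<in> diag p" "g \<in> diag p" for h g
    using that add[of "diag_op p h" "diag_op p g"] by (simp add: G_def diag_def op_add_diag_op)
  have Gsmul: "G (\<lambda>n. c * h n) = (\<lambda>i. c * G h i)" if "h \<in> diag p" for c h
    using that smul[of "diag_op p h" c] by (simp add: G_def diag_def op_smul_diag_op)
  have Gmul: "norm1 (G (\<lambda>n. h n * g n)) \<le> K * (norm1 (G h) * norm1 (G g))"
    if "h \<in> diag p" "g \<in> diag p" for h g
    using that mul[of "diag_op p h" "diag_op p g"] by (simp add: G_def diag_def op_mul_diag_op[OF p])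
  have Gpos: "norm1 (G h) > 0" if h: "h \<in> diag p" "m > 0" "h m \<noteq> 0" for h m
  proof -
    have "G h \<noteq> (\<lambda>i. 0)"
    proof
      assume "G h = (\<lambda>i. 0)"
      then have "diag_op p h = diag_op p (\<lambda>n. 0 * h n)"
        using inj[of "diag_op p h"] h(1) op_smul_diag_op[of 0 p h] by (simp add: G_def diag_def)
      then show False using diag_op_inj[of p h "\<lambda>n. 0 * h n" m] h by simp
    qed
    then show ?thesis using norm1_eq_0[OF Gl[OF h(1)]] norm1_nonneg[of "G h"] by linarith
  qed
  \<comment> \<open>For fixed \<open>n\<close> the \<open>q n i\<close> are the diagonals of
    orthogonal projections inside the corner of block \<open>n\<close>.\<close>
  define q where "q = (\<lambda>n i. block n (block i (\<lambda>_. 1)))"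
  have qg: "q n i \<in> gdiag p" for n i unfolding q_def by (intro gdiag_block p gdiag_1)
  have qd: "q n i \<in> diag p" for n i by (rule gdiag_diag[OF p qg])
  have qpos: "norm1 (G (q n i)) > 0" for n i
  proof -
    obtain k where "k > 0" "block i (\<lambda>_. 1) k \<noteq> 0" using block_nonzero[of 1 "\<lambda>_. 1" i] by auto
    then obtain k' where "k' > 0" "q n i k' \<noteq> 0"
      using block_nonzero[of k "block i (\<lambda>_. 1)" n] by (auto simp: q_def)
    then show ?thesis by (rule Gpos[OF qd])
  qed
  \<comment> \<open>The image of an idempotent has norm at most \<open>K\<close> times its own
    square, and the norm is positive, so one factor cancels.\<close>
  have qK: "1 \<le> K * norm1 (G (q n i))" for n i
  proof -
    have "(\<lambda>k. q n i k * q n i k) = q n i" by (simp add: q_def block_mult fun_eq_iff)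
    with Gmul[OF qd qd, of n i n i] have "1 * norm1 (G (q n i)) \<le> (K * norm1 (G (q n i))) * norm1 (G (q n i))"
      by simp
    then show ?thesis using qpos[of n i] mult_le_cancel_right_pos by blast
  qed
  have K: "K > 0"
    using qK[of 0 0] mult_nonpos_nonneg[OF _ norm1_nonneg, of K "G (q 0 0)"] by (cases "K > 0") auto
  have qlow: "1 / K \<le> norm1 (G (q n i))" for n i using qK[of n i] K by (simp add: field_simps)
  have Gsum: "G (\<lambda>k. \<Sum>i<N. \<epsilon> i * q n i k) = (\<lambda>x. \<Sum>i<N. \<epsilon> i * G (q n i) x)" for n N \<epsilon>
  proof (induction N)
    case 0 show ?case using Gsmul[OF qd, of 0 n 0] by simp
  next
    case (Suc N)
    have "(\<lambda>k. \<Sum>i<N. \<epsilon> i * q n i k) \<in> diag p"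
      by (intro gdiag_diag p gdiag_sum gdiag_smul qg)
    moreover have "(\<lambda>k. \<epsilon> N * q n N k) \<in> diag p" by (intro gdiag_diag p gdiag_smul qg)
    ultimately show ?case using Suc by (simp add: Gadd Gsmul[OF qd])
  qed
  define P where "P = (\<lambda>n. block n (\<lambda>_. 1))"
  have Pg: "P n \<in> gdiag p" for n unfolding P_def by (intro gdiag_block p gdiag_1)
  \<comment> \<open>All these images have norm at least \<open>1 / K\<close>, so some signed sum
    exceeds any prescribed bound; the factor \<open>4^n\<close> is chosen to beat the weight
    \<open>(1/2)^n\<close> in \<open>H\<close>.\<close>
  have "\<exists>N \<epsilon>. (\<forall>i. \<epsilon> i = 1 \<or> \<epsilon> i = -1) \<and>
      norm1 (\<lambda>x. \<Sum>i<N. \<epsilon> i * G (q n i) x) > 4^n * norm1 (G (P n))" for n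
    by (rule l1_signs_unbounded[OF _ qlow]) (use K Gl qd in auto)
  then obtain N \<epsilon> where \<epsilon>: "\<And>n. \<forall>i. \<epsilon> n i = 1 \<or> \<epsilon> n i = (-1::complex)"
    and big: "\<And>n. norm1 (\<lambda>x. \<Sum>i<N n. \<epsilon> n i * G (q n i) x) > 4^n * norm1 (G (P n))"
    by metis
  \<comment> \<open>The entries of \<open>w n\<close> have modulus at most 1 since the blocks are
    disjoint, and block \<open>n\<close> of it is the signed sum of the
    \<open>q n i\<close>.\<close>
  define w where "w = (\<lambda>n k. \<Sum>i<N n. \<epsilon> n i * block i (\<lambda>_. 1) k)"
  define y where "y = (\<lambda>n. block n (w n))"
  have yq: "y n = (\<lambda>k. \<Sum>i<N n. \<epsilon> n i * q n i k)" for n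
    by (simp add: y_def w_def q_def block_sum block_linear fun_eq_iff)
  have yg: "y n \<in> gdiag p" for n unfolding yq by (intro gdiag_sum gdiag_smul qg)
  have y1: "norm (y n k) \<le> 1" for n k
    unfolding y_def w_def by (rule block_norm_le[OF sum_block_signs_le[OF \<epsilon>]]) auto
  have ybig: "norm1 (G (y n)) > 4^n * norm1 (G (P n))" for n
    unfolding yq Gsum by (rule big)
  \<comment> \<open>The series of the \<open>(1/2)^n * y n\<close>; at position \<open>k\<close> it
    may stop before \<open>k\<close>, because block \<open>n\<close> vanishes at all positions up to
    \<open>n\<close>.\<close>
  define H where "H = (\<lambda>k. \<Sum>n<k. (1/2)^n * y n k)"
  have Hd: "H \<in> diag p"
  proof (rule diagI[OF p])
    fix e :: real assume "e > 0"
    \<comment> \<open>The tail from \<open>m\<close> on is at most \<open>2 * (1/2)^m\<close>, hence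
      the threshold \<open>e/2\<close>.\<close>
    then obtain m where m: "(1/2)^m < e/2" using real_arch_pow_inv[of "e/2" "1/2"] by auto
    have "norm (H k - (\<Sum>n<m. (1/2)^n * y n k)) \<le> e" for k
    proof (cases "k \<le> m")
      case True
      have "(\<Sum>n<m. (1/2)^n * y n k) = H k" unfolding H_def
        using True by (intro sum.mono_neutral_right) (auto simp: y_def block_small)
      then show ?thesis using \<open>e > 0\<close> by simp
    next
      case False
      then have "H k = (\<Sum>n<m. (1/2)^n * y n k) + (\<Sum>n\<in>{m..<k}. (1/2)^n * y n k)"
        using sum.atLeastLessThan_concat[of 0 m k "\<lambda>n. (1/2)^n * y n k"]
        by (simp add: H_def atLeast0LessThan)
      then have "norm (H k - (\<Sum>n<m. (1/2)^n * y n k)) = norm (\<Sum>n\<in>{m..<k}. (1/2)^n * y n k)"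
        by simp
      also have "\<dots> \<le> (\<Sum>n\<in>{m..<k}. (1/2)^n)"
      proof (rule sum_norm_le)
        fix n
        have "norm ((1/2)^n * y n k) = (1/2)^n * norm (y n k)"
          by (simp add: norm_mult norm_power norm_divide)
        also have "\<dots> \<le> (1/2)^n" using y1[of n k] by (intro mult_left_le) auto
        finally show "norm ((1/2)^n * y n k) \<le> (1/2)^n" .
      qed
      also have "\<dots> \<le> e" using geometric_tail[of m k] m by simp
      finally show ?thesis .
    qed
    moreover have "(\<lambda>k. \<Sum>n<m. (1/2)^n * y n k) \<in> gdiag p"
      by (intro gdiag_sum gdiag_smul yg)
    ultimately show "\<exists>g\<in>gdiag p. \<forall>n. norm (H n - g n) \<le> e"
      by (intro bexI[of _ "\<lambda>k. \<Sum>n<m. (1/2)^n * y n k"] allI)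
  qed
  have HP: "(\<lambda>k. H k * P n k) = (\<lambda>k. (1/2)^n * y n k)" for n
  proof
    fix k
    have t: "(1/2)^j * y j k * P n k = (if j = n then (1/2)^n * y n k else 0)" for j
      unfolding y_def P_def mult.assoc block_mult by simp
    have "H k * P n k = (\<Sum>j<k. if j = n then (1/2)^n * y n k else 0)"
      unfolding H_def sum_distrib_right t ..
    \<comment> \<open>For \<open>k \<le> n\<close> the index \<open>n\<close> is outside the sum,
      but then \<open>y n k\<close> is 0 by \<open>block_small\<close>.\<close>
    also have "\<dots> = (1/2)^n * y n k" by (simp add: y_def block_small)
    finally show "H k * P n k = (1/2)^n * y n k" .
  qed
  \<comment> \<open>\<open>(1/2)^n * 4^n = 2^n\<close>, and the common factor
    \<open>norm1 (G (P n))\<close> cancels because it is positive.\<close>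
  have bound: "2^n \<le> K * norm1 (G H)" for n :: nat
  proof -
    have "(1/2)^n * (4^n * norm1 (G (P n))) \<le> (1/2)^n * norm1 (G (y n))"
      using ybig[of n] by simp
    also have "\<dots> = norm1 (G (\<lambda>k. (1/2)^n * y n k))"
      by (simp add: Gsmul[OF gdiag_diag[OF p yg]] norm1_cmult norm_power norm_divide)
    also have "\<dots> \<le> K * (norm1 (G H) * norm1 (G (P n)))"
      unfolding HP[symmetric] by (rule Gmul[OF Hd gdiag_diag[OF p Pg]])
    finally have "2^n * norm1 (G (P n)) \<le> K * norm1 (G H) * norm1 (G (P n))"
      by (simp add: power_mult_distrib[symmetric] mult.assoc[symmetric])
    moreover have "norm1 (G (P n)) > 0"
      using block_nonzero[of 1 "\<lambda>_. 1" n] Gpos[OF gdiag_diag[OF p Pg]] unfolding P_def by auto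
    ultimately show ?thesis by simp
  qed
  obtain n :: nat where "K * norm1 (G H) < 2^n" using real_arch_pow[of 2] by auto
  with bound[of n] show False by simp
qed

section \<open>Comparison of the two algebras\<close>

text \<open>The composition of \<open>\<theta>\<close> with \<open>emb\<close> meets the assumptions
  of \<open>no_l1_embedding\<close>, with \<open>K = 2\<close>.\<close>

lemma no_injective_hom:
  assumes p: "p > 0" and inj: "inj_on \<theta> (O2p_set p)" and car: "\<theta> ` O2p_set p \<subseteq> carrier AJ"
    and hom: "alg_hom (O2p p) AJ \<theta>"
  shows False
proof -
  have rep: "\<exists>f\<in>ell1. \<theta> S = coset f" if "S \<in> O2p_set p" for S
    using that car AJ_carrier by blast
  have hom_add: "\<theta> (op_add S T) = add AJ (\<theta> S) (\<theta> T)"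
    and hom_mul: "\<theta> (op_mul S T) = mul AJ (\<theta> S) (\<theta> T)"
    if "S \<in> O2p_set p" "T \<in> O2p_set p" for S T
    using that hom by (auto simp: alg_hom_def O2p_def)
  have hom_smul: "\<theta> (op_smul c S) = smul AJ c (\<theta> S)" if "S \<in> O2p_set p" for c S
    using that hom by (auto simp: alg_hom_def O2p_def)
  show False
  proof (rule no_l1_embedding[OF p, of "\<lambda>S. emb (\<theta> S)" 2])
    fix S assume S: "S \<in> O2p_set p"
    from rep[OF S] obtain f where f: "f \<in> ell1" "\<theta> S = coset f" by blast
    show "l1 (emb (\<theta> S))" unfolding f(2) emb_coset[OF f(1)] by (rule proj_kernel.kernel_op_l1[OF ell1_l1[OF f(1)]])
    have smul: "\<theta> (op_smul c S) = coset (\<lambda>s. c * f s)" for c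
      unfolding hom_smul[OF S] f(2) by (rule AJ_smul[OF f(1)])
    show "emb (\<theta> (op_smul c S)) = (\<lambda>i. c * emb (\<theta> S) i)" for c
      unfolding smul f(2) emb_coset[OF f(1)] emb_coset[OF ell1_cmult[OF f(1)]] coords_cmult proj_kernel.kernel_op_cmult ..
    show "S = op_smul 0 S" if z: "emb (\<theta> S) = (\<lambda>i. 0)"
    proof (rule inj_onD[OF inj _ S])
      \<comment> \<open>Written as a diagonal operator with entries 0, the zero operator is seen to
        lie in \<open>O2p_set p\<close>.\<close>
      have "op_smul 0 S = diag_op p (\<lambda>n. 0 * 1)" by (auto simp: op_smul_def diag_op_def op_restr_def)
      then show "op_smul 0 S \<in> O2p_set p"
        using gdiag_diag[OF p gdiag_smul[OF gdiag_1, of 0]] by (simp add: diag_def)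
      have "L (coords f) = L (coords (\<lambda>s. 0 * f s))"
        using z unfolding f(2) emb_coset[OF f(1)] coords_cmult proj_kernel.kernel_op_cmult by simp
      then show "\<theta> S = \<theta> (op_smul 0 S)"
        unfolding smul f(2) coset_eq[OF f(1)] coset_eq[OF ell1_cmult[OF f(1)]] by simp
    qed
    fix T assume T: "T \<in> O2p_set p"
    from rep[OF T] obtain g where g: "g \<in> ell1" "\<theta> T = coset g" by blast
    show "emb (\<theta> (op_add S T)) = (\<lambda>i. emb (\<theta> S) i + emb (\<theta> T) i)"
      unfolding hom_add[OF S T] f(2) g(2) AJ_add[OF f(1) g(1)]
        emb_coset[OF f(1)] emb_coset[OF g(1)] emb_coset[OF ell1_add[OF f(1) g(1)]] coords_add
      by (rule proj_kernel.kernel_op_add[OF ell1_l1[OF f(1)] ell1_l1[OF g(1)]])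
    show "norm1 (emb (\<theta> (op_mul S T))) \<le> 2 * (norm1 (emb (\<theta> S)) * norm1 (emb (\<theta> T)))"
      unfolding hom_mul[OF S T] f(2) g(2) AJ_mul[OF f(1) g(1)]
        emb_coset[OF f(1)] emb_coset[OF g(1)] emb_coset[OF conv_ell1[OF f(1) g(1)]] coords_conv
      by (rule norm1_L_pconv[OF ell1_l1[OF f(1)] ell1_l1[OF g(1)]])
  qed
qed

lemma AJ_closed:
  assumes "X \<in> carrier AJ" "Y \<in> carrier AJ"
  shows "add AJ X Y \<in> carrier AJ" "mul AJ X Y \<in> carrier AJ" "smul AJ c X \<in> carrier AJ"
proof -
  obtain f where f: "f \<in> ell1" "X = coset f" using assms(1) unfolding AJ_carrier by blast
  obtain g where g: "g \<in> ell1" "Y = coset g" using assms(2) unfolding AJ_carrier by blast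
  show "add AJ X Y \<in> carrier AJ"
    unfolding f(2) g(2) AJ_add[OF f(1) g(1)] AJ_carrier by (rule bexI[OF refl ell1_add[OF f(1) g(1)]])
  show "mul AJ X Y \<in> carrier AJ"
    unfolding f(2) g(2) AJ_mul[OF f(1) g(1)] AJ_carrier by (rule bexI[OF refl conv_ell1[OF f(1) g(1)]])
  show "smul AJ c X \<in> carrier AJ"
    unfolding f(2) AJ_smul[OF f(1)] AJ_carrier by (rule bexI[OF refl ell1_cmult[OF f(1)]])
qed

lemma inverse_hom:
  assumes bij: "bij_betw \<phi> (carrier AJ) (O2p_set p)" and hom: "alg_hom AJ (O2p p) \<phi>"
  shows "alg_hom (O2p p) AJ (inv_into (carrier AJ) \<phi>)"
proof -
  define \<theta> where "\<theta> = inv_into (carrier AJ) \<phi>"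
  have car: "\<theta> S \<in> carrier AJ" and inv: "\<phi> (\<theta> S) = S" if "S \<in> O2p_set p" for S
    using that bij unfolding \<theta>_def bij_betw_def by (metis inv_into_into, metis f_inv_into_f)
  have inv': "\<theta> (\<phi> X) = X" if "X \<in> carrier AJ" for X
    using that bij by (simp add: \<theta>_def bij_betw_def)
  have "\<theta> (op_add S T) = add AJ (\<theta> S) (\<theta> T) \<and> \<theta> (op_mul S T) = mul AJ (\<theta> S) (\<theta> T)"
    if ST: "S \<in> O2p_set p" "T \<in> O2p_set p" for S T
  proof -
    have "\<phi> (add AJ (\<theta> S) (\<theta> T)) = op_add S T" "\<phi> (mul AJ (\<theta> S) (\<theta> T)) = op_mul S T"
      using hom car[OF ST(1)] car[OF ST(2)] inv[OF ST(1)] inv[OF ST(2)] by (auto simp: alg_hom_def O2p_def)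
    then show ?thesis using inv' AJ_closed(1,2)[OF car[OF ST(1)] car[OF ST(2)]] by metis
  qed
  moreover have "\<theta> (op_smul c S) = smul AJ c (\<theta> S)" if S: "S \<in> O2p_set p" for c S
  proof -
    have "\<phi> (smul AJ c (\<theta> S)) = op_smul c S"
      using hom car[OF S] inv[OF S] by (auto simp: alg_hom_def O2p_def)
    then show ?thesis using inv' AJ_closed(3)[OF car[OF S] car[OF S]] by metis
  qed
  ultimately show ?thesis unfolding \<theta>_def[symmetric] by (simp add: alg_hom_def O2p_def)
qed

theorem theorem4p1:
  fixes p :: real
  assumes "1 \<le> p"
  shows "\<not> (\<exists>\<phi>. alg_iso AJ (O2p p) \<phi>) \<and> \<not> (\<exists>\<psi>. alg_iso (O2p p) AJ \<psi>)"
proof (intro conjI notI; elim exE)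
  have p: "p > 0" using assms by simp
  have car: "carrier (O2p p) = O2p_set p" by (simp add: O2p_def)
  {
    fix \<phi> assume "alg_iso AJ (O2p p) \<phi>"
    then have bij: "bij_betw \<phi> (carrier AJ) (O2p_set p)" and hom: "alg_hom AJ (O2p p) \<phi>"
      by (auto simp: alg_iso_def car)
    \<comment> \<open>The inverse is an injective homomorphism out of \<open>O2p p\<close>, which
      reduces this case to the other direction.\<close>
    have "bij_betw (inv_into (carrier AJ) \<phi>) (O2p_set p) (carrier AJ)" by (rule bij_betw_inv_into[OF bij])
    then show False
      using no_injective_hom[OF p _ _ inverse_hom[OF bij hom]] by (auto simp: bij_betw_def)
  next
    fix \<psi> assume "alg_iso (O2p p) AJ \<psi>"
    then have "bij_betw \<psi> (O2p_set p) (carrier AJ)" "alg_hom (O2p p) AJ \<psi>"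
      by (auto simp: alg_iso_def car)
    then show False using no_injective_hom[OF p, of \<psi>] by (auto simp: bij_betw_def)
  }
qed

end
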